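(* Let $G$ be a group and let $\alpha,\beta\colon G\to\mathrm{Homeo}^+(I)$ be two faithful actions of $G$ as a chain group (that is, $\alpha(G)$ and $\beta(G)$ are chain groups of homeomorphisms of $I$) which are minimal. Then there exists a homeomorphism $h\colon I\to I$ such that for all $g\in G$ and $x\in I$ we have $$\alpha(g)(x)=h\circ\beta(g)\circ h^{-1}(x).$$
   Context: $I=[0,1]$, $\mathrm{Homeo}^+(I)$ is the group of orientation preserving homeomorphisms of $I$, and $\operatorname{supp} f=\{x: f(x)\ne x\}$. For an interval $J$, $\partial^-J$ is its left endpoint. Chain of intervals: a collection $\{J_1,\ldots,J_n\}$ of nonempty open subintervals (here, of $(0,1)$) such that $J_i\cap J_k=\varnothing$ if $|i-k|>1$, and $J_i\cap J_{i+1}$ is a proper nonempty subinterval of both $J_i$ and $J_{i+1}$ for $1\le i\le n-1$. Chain group of homeomorphisms of $I$: a group $\langle f_1,\ldots,f_n\rangle\le\mathrm{Homeo}^+(I)$ for some $n\ge2$, where $\{\operatorname{supp} f_1,\dots,\operatorname{supp} f_n\}$ is a chain of intervals with $\partial^-\operatorname{supp} f_i<\partial^-\operatorname{supp} f_{i+1}$ for all $i<n$, $f_i(t)\ge t$ for all $t\in I$ and all $i$, and $\langle f_i,f_{i+1}\rangle\cong F$ for each $1\le i\le n-1$. Here $F=\langle \{g_i\}_{i\ge0}\mid g_i^{-1}g_jg_i=g_{j+1}\text{ for }0\le i<j\rangle$ is Thompson's group. The numbers of generators for $\alpha(G)$ and $\beta(G)$ need not agree. An action of $G$ on $I$ is minimal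 if for all $x\in(0,1)$ the orbit $G.x$ is dense in $I$. *)

theory Defs
  imports "HOL-Analysis.Analysis" "HOL-Algebra.Generated_Groups" "HOL-Algebra.Group_Action"
begin

section \<open>Groups given by generators and relations\<close>

text \<open>
  The letter \<open>(True, x)\<close> stands for the generator \<open>x\<close> and \<open>(False, x)\<close> for its formal
  inverse. A pair of words \<open>(l, r) \<in> R\<close> is the defining relation \<open>l = r\<close>.
\<close>

type_synonym 'a word = "(bool \<times> 'a) list"

inductive word_eq :: "('a word \<times> 'a word) set \<Rightarrow> 'a word \<Rightarrow> 'a word \<Rightarrow> bool"
  for R :: "('a word \<times> 'a word) set"
where
  word_eq_refl: "word_eq R u u"
| word_eq_sym: "word_eq R u v \<Longrightarrow> word_eq R v u"
| word_eq_trans: "word_eq R u v \<Longrightarrow> word_eq R v w \<Longrightarrow> word_eq R u w"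
| word_eq_cancel: "word_eq R (u @ [(b, x), (\<not> b, x)] @ v) (u @ v)"
| word_eq_relation: "(l, r) \<in> R \<Longrightarrow> word_eq R (u @ l @ v) (u @ r @ v)"

definition word_class :: "('a word \<times> 'a word) set \<Rightarrow> 'a word \<Rightarrow> 'a word set" where
  "word_class R u = {v. word_eq R u v}"

text \<open>
  The generating set is the whole type \<open>'a\<close>. The product is the class of the concatenation of
  representatives; it is independent of their choice by \<open>presented_group_mult\<close>.
\<close>

definition presented_group :: "('a word \<times> 'a word) set \<Rightarrow> 'a word set monoid" where
  "presented_group R =
    \<lparr>carrier = range (word_class R),
     mult = (\<lambda>A B. \<Union>u\<in>A. \<Union>v\<in>B. word_class R (u @ v)),
     one = word_class R []\<rparr>"

lemma word_eq_context: "word_eq R u v \<Longrightarrow> word_eq R (a @ u @ b) (a @ v @ b)"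
proof (induction rule: word_eq.induct)
  case (word_eq_cancel u c x v)
  then show ?case using word_eq.intros(4)[of R "a @ u" c x "v @ b"] by simp
next
  case (word_eq_relation l r u v)
  then show ?case using word_eq.intros(5)[of l r R "a @ u" "v @ b"] by simp
qed (blast intro: word_eq.intros)+

lemma word_eq_append:
  assumes "word_eq R u u'" "word_eq R v v'"
  shows "word_eq R (u @ v) (u' @ v')"
  using word_eq_context[OF assms(1), of "[]" v] word_eq_context[OF assms(2), of u' "[]"]
  by (auto intro: word_eq_trans)

lemma word_class_eq_iff: "word_class R u = word_class R v \<longleftrightarrow> word_eq R u v"
  unfolding word_class_def by (auto intro: word_eq.intros)

lemma presented_group_mult:
  "word_class R u \<otimes>\<^bsub>presented_group R\<^esub> word_class R v = word_class R (u @ v)"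
proof -
  have "word_class R (u' @ v') = word_class R (u @ v)"
    if "u' \<in> word_class R u" "v' \<in> word_class R v" for u' v'
    using that by (metis mem_Collect_eq word_class_def word_class_eq_iff word_eq_sym word_eq_append)
  moreover have "u \<in> word_class R u" "v \<in> word_class R v"
    by (simp_all add: word_class_def word_eq_refl)
  ultimately have "(\<Union>u'\<in>word_class R u. \<Union>v'\<in>word_class R v. word_class R (u' @ v')) = word_class R (u @ v)"
    by blast
  then show ?thesis
    by (simp add: presented_group_def)
qed

lemma word_eq_inverse: "word_eq R (rev (map (map_prod Not id) w) @ w) []"
proof (induction w)
  case Nil
  then show ?case by (simp add: word_eq_refl)
next
  case (Cons a w)
  obtain b x where a: "a = (b, x)" by (cases a)
  have "word_eq R (rev (map (map_prod Not id) (a # w)) @ a # w)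
          (rev (map (map_prod Not id) w) @ w)"
    using word_eq_cancel[of R "rev (map (map_prod Not id) w)" "\<not> b" x w] by (simp add: a)
  then show ?case using Cons word_eq_trans by blast
qed

lemma group_presented_group: "group (presented_group R)"
proof (rule groupI)
  have carr: "carrier (presented_group R) = range (word_class R)"
    and one: "\<one>\<^bsub>presented_group R\<^esub> = word_class R []"
    by (simp_all add: presented_group_def)
  show "x \<otimes>\<^bsub>presented_group R\<^esub> y \<in> carrier (presented_group R)"
    if "x \<in> carrier (presented_group R)" "y \<in> carrier (presented_group R)" for x y
    using that by (auto simp: carr presented_group_mult)
  show "\<one>\<^bsub>presented_group R\<^esub> \<in> carrier (presented_group R)"
    by (simp add: carr one)
  show "x \<otimes>\<^bsub>presented_group R\<^esub> y \<otimes>\<^bsub>presented_group R\<^esub> z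
      = x \<otimes>\<^bsub>presented_group R\<^esub> (y \<otimes>\<^bsub>presented_group R\<^esub> z)"
    if "x \<in> carrier (presented_group R)" "y \<in> carrier (presented_group R)"
      "z \<in> carrier (presented_group R)" for x y z
    using that by (auto simp: carr presented_group_mult)
  show "\<one>\<^bsub>presented_group R\<^esub> \<otimes>\<^bsub>presented_group R\<^esub> x = x"
    if "x \<in> carrier (presented_group R)" for x
    using that by (auto simp: carr one presented_group_mult)
  show "\<exists>y\<in>carrier (presented_group R). y \<otimes>\<^bsub>presented_group R\<^esub> x = \<one>\<^bsub>presented_group R\<^esub>"
    if x: "x \<in> carrier (presented_group R)" for x
  proof -
    obtain w where w: "x = word_class R w" using x by (auto simp: carr)
    show ?thesis
      by (rule bexI[of _ "word_class R (rev (map (map_prod Not id) w))"])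
        (auto simp: w carr one presented_group_mult word_class_eq_iff word_eq_inverse)
  qed
qed

definition thompson_relations :: "(nat word \<times> nat word) set" where
  "thompson_relations =
    {([(False, i), (True, j), (True, i)], [(True, j + 1)]) | i j. i < j}"

definition thompson_F :: "nat word set monoid" where
  "thompson_F = presented_group thompson_relations"


section \<open>Orientation preserving homeomorphisms of the unit interval\<close>

abbreviation unit_ivl :: "real set" where
  "unit_ivl \<equiv> {0..1}"

text \<open>
  As in \<^const>\<open>BijGroup\<close>, the elements are extensional functions, so that distinct elements differ
  at a point of the interval; the product is composition.
\<close>

definition homeo_plus :: "(real \<Rightarrow> real) set" where
  "homeo_plus =
    {f \<in> Bij unit_ivl. (\<exists>g. homeomorphism unit_ivl unit_ivl f g) \<and> strict_mono_on unit_ivl f}"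

definition HomeoPlus :: "(real \<Rightarrow> real) monoid" where
  "HomeoPlus = BijGroup unit_ivl\<lparr>carrier := homeo_plus\<rparr>"

lemma subgroup_homeo_plus: "subgroup homeo_plus (BijGroup unit_ivl)"
proof (rule group.subgroupI[OF group_BijGroup])
  show "homeo_plus \<subseteq> carrier (BijGroup unit_ivl)"
    by (auto simp: homeo_plus_def BijGroup_def)
  have "homeomorphism unit_ivl unit_ivl (\<lambda>x\<in>unit_ivl. x) (\<lambda>x. x)"
    using homeomorphism_cong[OF homeomorphism_ident[of unit_ivl] refl refl,
      where f' = "\<lambda>x\<in>unit_ivl. x" and g' = "\<lambda>x. x"] by simp
  then have "(\<lambda>x\<in>unit_ivl. x) \<in> homeo_plus"
    unfolding homeo_plus_def using id_Bij by (auto simp: strict_mono_on_def)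
  then show "homeo_plus \<noteq> {}" by blast
next
  fix f assume f: "f \<in> homeo_plus"
  then obtain g where fB: "f \<in> Bij unit_ivl" and g: "homeomorphism unit_ivl unit_ivl f g"
    and mono: "strict_mono_on unit_ivl f"
    by (auto simp: homeo_plus_def)
  define k where "k = (\<lambda>x\<in>unit_ivl. inv_into unit_ivl f x)"
  have inv: "inv\<^bsub>BijGroup unit_ivl\<^esub> f = k"
    using inv_BijGroup[OF fB] by (simp add: k_def)
  have kB: "k \<in> Bij unit_ivl"
    unfolding k_def using fB by (rule restrict_inv_into_Bij)
  have inj: "inj_on f unit_ivl" using fB by (simp add: Bij_def bij_betw_def)
  have kg: "k y = g y" if "y \<in> unit_ivl" for y
  proof -
    have "g y \<in> unit_ivl" "f (g y) = y" using g that by (auto simp: homeomorphism_def)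
    then have "inv_into unit_ivl f y = g y" using inj by (metis inv_into_f_f)
    then show ?thesis using that by (simp add: k_def)
  qed
  have "homeomorphism unit_ivl unit_ivl k f"
    using homeomorphism_cong[OF homeomorphism_symD[OF g] refl refl, where f' = k and g' = f] kg by auto
  moreover have "strict_mono_on unit_ivl k"
  proof (rule strict_mono_onI)
    fix x y :: real assume xy: "x \<in> unit_ivl" "y \<in> unit_ivl" "x < y"
    have "f (k x) = x" "f (k y) = y" "k x \<in> unit_ivl" "k y \<in> unit_ivl"
      using g xy kg by (auto simp: homeomorphism_def)
    then show "k x < k y"
      using mono xy(3) by (metis strict_mono_on_less)
  qed
  ultimately show "inv\<^bsub>BijGroup unit_ivl\<^esub> f \<in> homeo_plus"
    using kB inv by (auto simp: homeo_plus_def)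
next
  fix a b assume "a \<in> homeo_plus" "b \<in> homeo_plus"
  then obtain a' b' where ab: "a \<in> Bij unit_ivl" "b \<in> Bij unit_ivl"
    and ha: "homeomorphism unit_ivl unit_ivl a a'" and hb: "homeomorphism unit_ivl unit_ivl b b'"
    and mono: "strict_mono_on unit_ivl a" "strict_mono_on unit_ivl b"
    by (auto simp: homeo_plus_def)
  have "homeomorphism unit_ivl unit_ivl (compose unit_ivl a b) (b' \<circ> a')"
    using homeomorphism_cong[OF homeomorphism_compose[OF hb ha] refl refl,
      where f' = "compose unit_ivl a b" and g' = "b' \<circ> a'"]
    by (auto simp: compose_def)
  moreover have "strict_mono_on unit_ivl (compose unit_ivl a b)"
  proof (rule strict_mono_onI)
    fix x y :: real assume xy: "x \<in> unit_ivl" "y \<in> unit_ivl" "x < y"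
    then have "b x \<in> unit_ivl" "b y \<in> unit_ivl" using hb by (auto simp: homeomorphism_def)
    then show "compose unit_ivl a b x < compose unit_ivl a b y"
      using mono xy by (auto simp: compose_def strict_mono_on_def)
  qed
  ultimately have "compose unit_ivl a b \<in> homeo_plus"
    using compose_Bij[OF ab] by (auto simp: homeo_plus_def)
  then show "a \<otimes>\<^bsub>BijGroup unit_ivl\<^esub> b \<in> homeo_plus"
    using ab by (simp add: BijGroup_def)
qed

lemma group_HomeoPlus: "group HomeoPlus"
  unfolding HomeoPlus_def
  by (rule subgroup.subgroup_is_group[OF subgroup_homeo_plus group_BijGroup])


section \<open>Chain groups\<close>

definition supp :: "(real \<Rightarrow> real) \<Rightarrow> real set" where
  "supp f = {x \<in> unit_ivl. f x \<noteq> x}"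

definition chain_of_intervals :: "nat \<Rightarrow> (nat \<Rightarrow> real set) \<Rightarrow> bool" where
  "chain_of_intervals n J \<longleftrightarrow>
    (\<forall>i\<in>{1..n}. J i \<noteq> {} \<and> open (J i) \<and> is_interval (J i) \<and> J i \<subseteq> {0<..<1}) \<and>
    (\<forall>i\<in>{1..n}. \<forall>k\<in>{1..n}. \<bar>int i - int k\<bar> > 1 \<longrightarrow> J i \<inter> J k = {}) \<and>
    (\<forall>i. 1 \<le> i \<and> i < n \<longrightarrow>
      is_interval (J i \<inter> J (i + 1)) \<and> J i \<inter> J (i + 1) \<noteq> {} \<and>
      J i \<inter> J (i + 1) \<subset> J i \<and> J i \<inter> J (i + 1) \<subset> J (i + 1))"

text \<open>
  For a nonempty bounded interval \<open>J\<close>, the left endpoint is \<open>Inf J\<close>.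
\<close>

definition chain_group :: "(real \<Rightarrow> real) set \<Rightarrow> bool" where
  "chain_group H \<longleftrightarrow>
    (\<exists>n \<ge> 2. \<exists>f. f ` {1..n} \<subseteq> carrier HomeoPlus \<and>
      H = generate HomeoPlus (f ` {1..n}) \<and>
      chain_of_intervals n (\<lambda>i. supp (f i)) \<and>
      (\<forall>i. 1 \<le> i \<and> i < n \<longrightarrow> Inf (supp (f i)) < Inf (supp (f (i + 1)))) \<and>
      (\<forall>i\<in>{1..n}. \<forall>t\<in>unit_ivl. f i t \<ge> t) \<and>
      (\<forall>i. 1 \<le> i \<and> i < n \<longrightarrow>
        HomeoPlus\<lparr>carrier := generate HomeoPlus {f i, f (i + 1)}\<rparr> \<cong> thompson_F))"


section \<open>Actions on the unit interval\<close>

definition faithful_chain_action :: "('g, 'm) monoid_scheme \<Rightarrow> ('g \<Rightarrow> real \<Rightarrow> real) \<Rightarrow> bool" where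
  "faithful_chain_action G \<phi> \<longleftrightarrow>
    \<phi> \<in> hom G HomeoPlus \<and> inj_on \<phi> (carrier G) \<and> chain_group (\<phi> ` carrier G)"

definition minimal_action :: "('g, 'm) monoid_scheme \<Rightarrow> ('g \<Rightarrow> real \<Rightarrow> real) \<Rightarrow> bool" where
  "minimal_action G \<phi> \<longleftrightarrow> (\<forall>x\<in>{0<..<1}. unit_ivl \<subseteq> closure (orbit G \<phi> x))"

end

theory Submission
  imports Defs
begin

text \<open>
  This is a one-dimensional instance of Rubin's theorem. The chain structure enters through
  minimality, generators with supports \<open>(0, b)\<close> and \<open>(a, 1)\<close>, and the commutativity of germs at
  the ends \<open>0\<close> and \<open>1\<close>.

  Commutators have trivial germs at \<open>0\<close> and \<open>1\<close>, hence compact support in \<open>(0, 1)\<close>. By minimality,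
  every point \<open>x\<close> is moved by such a commutator, and conjugates of the two extremal generators allow
  one to shrink its support into any neighbourhood of \<open>x\<close> while fixing \<open>x\<close>. So the action is
  locally moving. For such actions, disjointness of the supports of two elements can be expressed in
  terms of the group alone, hence is the same for both actions. Call \<open>x\<close> and \<open>y\<close> related if no
  element moving \<open>x\<close> in the first action is disjoint from an element moving \<open>y\<close> in the second. This
  relation is closed and equivariant, and it is the graph of the conjugating homeomorphism.
\<close>

section \<open>Locally moving actions\<close>

text \<open>Disjointness of supports passes from one action to the other, but the ends 0 and 1 are
  not visible in the group: the points that ought to correspond to \<open>x\<close> might escape to
  an end in the second action. Commutators are the remedy. Being a commutator does not depend on the
  action, so a single group element can move \<open>x\<close> in the first action and have its
  support inside some \<open>{u..v}\<close> with \<open>0 < u\<close> and \<open>v < 1\<close> in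
  the second. This compact set turns the search for a partner of \<open>x\<close> into a finite
  intersection argument, and it makes a correspondence with closed graph continuous. Germs at the
  ends commute because near 0 only the first generator differs from the identity, and near 1 only
  the last. The relation does not record orientation: the resulting map may be decreasing, so its
  values at the ends are settled only after the map is known on the open interval.\<close>

definition commutator :: "('a, 'b) monoid_scheme \<Rightarrow> 'a \<Rightarrow> 'a \<Rightarrow> 'a" where
  "commutator G a b = a \<otimes>\<^bsub>G\<^esub> b \<otimes>\<^bsub>G\<^esub> inv\<^bsub>G\<^esub> a \<otimes>\<^bsub>G\<^esub> inv\<^bsub>G\<^esub> b"

definition commutes :: "('a, 'b) monoid_scheme \<Rightarrow> 'a \<Rightarrow> 'a \<Rightarrow> bool" where
  "commutes G a b \<longleftrightarrow> a \<otimes>\<^bsub>G\<^esub> b = b \<otimes>\<^bsub>G\<^esub> a"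

text \<open>Rubin's algebraic form of disjointness: with \<open>a\<close> and \<open>b\<close> in
  the centralizer of \<open>g\<close>, the double commutator [a, [b, h]] is nontrivial and lies in
  that centralizer too. Nontriviality is written as \<open>a\<close> not commuting with
  [b, h].\<close>

definition algebraically_disjoint :: "('a, 'b) monoid_scheme \<Rightarrow> 'a \<Rightarrow> 'a \<Rightarrow> bool" where
  "algebraically_disjoint G f g \<longleftrightarrow>
    (\<forall>h\<in>carrier G. \<not> commutes G f h \<longrightarrow>
      (\<exists>a\<in>carrier G. \<exists>b\<in>carrier G. commutes G a g \<and> commutes G b g \<and>
        \<not> commutes G a (commutator G b h) \<and>
        commutes G (commutator G a (commutator G b h)) g))"

text \<open>The endpoints are left out because every increasing homeomorphism fixes them. The
  topology is carried by order and invertibility: openness of supports (\<open>open_moved\<close>)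
  comes from the displacement of small windows.\<close>

locale interval_action = group G for G (structure) +
  fixes \<phi> :: "'a \<Rightarrow> real \<Rightarrow> real"
  assumes act_closed: "g \<in> carrier G \<Longrightarrow> x \<in> {0<..<1} \<Longrightarrow> \<phi> g x \<in> {0<..<1}"
    and act_mult: "g \<in> carrier G \<Longrightarrow> h \<in> carrier G \<Longrightarrow> x \<in> {0<..<1} \<Longrightarrow> \<phi> (g \<otimes> h) x = \<phi> g (\<phi> h x)"
    and act_mono: "g \<in> carrier G \<Longrightarrow> x \<in> {0<..<1} \<Longrightarrow> y \<in> {0<..<1} \<Longrightarrow> x < y \<Longrightarrow> \<phi> g x < \<phi> g y"
    and faithful: "g \<in> carrier G \<Longrightarrow> (\<And>x. x \<in> {0<..<1} \<Longrightarrow> \<phi> g x = x) \<Longrightarrow> g = \<one>"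
begin

lemma commutator_closed [simp, intro]:
  "a \<in> carrier G \<Longrightarrow> b \<in> carrier G \<Longrightarrow> commutator G a b \<in> carrier G"
  by (simp add: commutator_def)

lemma act_less_iff:
  assumes "g \<in> carrier G" "x \<in> {0<..<1}" "y \<in> {0<..<1}"
  shows "\<phi> g x < \<phi> g y \<longleftrightarrow> x < y"
  using act_mono[OF assms] act_mono[OF assms(1,3,2)] by (cases x y rule: linorder_cases) auto

lemma act_inject:
  assumes "g \<in> carrier G" "x \<in> {0<..<1}" "y \<in> {0<..<1}"
  shows "\<phi> g x = \<phi> g y \<longleftrightarrow> x = y"
  using act_mono[OF assms] act_mono[OF assms(1,3,2)] by (cases x y rule: linorder_cases) auto

lemma act_one: "x \<in> {0<..<1} \<Longrightarrow> \<phi> \<one> x = x"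
  using act_mult[of \<one> \<one> x] act_inject[of \<one> "\<phi> \<one> x" x] act_closed[of \<one> x] by simp

lemma act_inv: "g \<in> carrier G \<Longrightarrow> x \<in> {0<..<1} \<Longrightarrow> \<phi> (inv g) (\<phi> g x) = x"
  using act_mult[of "inv g" g x] by (simp add: act_one)

lemma act_inv2: "g \<in> carrier G \<Longrightarrow> x \<in> {0<..<1} \<Longrightarrow> \<phi> g (\<phi> (inv g) x) = x"
  using act_inv[of "inv g" x] by simp

lemma act_inv_eq_iff:
  "g \<in> carrier G \<Longrightarrow> x \<in> {0<..<1} \<Longrightarrow> y \<in> {0<..<1} \<Longrightarrow> \<phi> (inv g) x = y \<longleftrightarrow> x = \<phi> g y"
  using act_inv act_inv2 by metis

lemma act_inv_less_iff:
  "g \<in> carrier G \<Longrightarrow> x \<in> {0<..<1} \<Longrightarrow> y \<in> {0<..<1} \<Longrightarrow> \<phi> (inv g) x < y \<longleftrightarrow> x < \<phi> g y"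
  using act_less_iff[of g "\<phi> (inv g) x" y] act_inv2[of g x] act_closed[of "inv g" x] by simp

lemma less_act_inv_iff:
  "g \<in> carrier G \<Longrightarrow> x \<in> {0<..<1} \<Longrightarrow> y \<in> {0<..<1} \<Longrightarrow> y < \<phi> (inv g) x \<longleftrightarrow> \<phi> g y < x"
  using act_less_iff[of g y "\<phi> (inv g) x"] act_inv2[of g x] act_closed[of "inv g" x] by simp

lemma eq_iff_act_eq:
  assumes "g \<in> carrier G" "h \<in> carrier G"
  shows "g = h \<longleftrightarrow> (\<forall>x\<in>{0<..<1}. \<phi> g x = \<phi> h x)"
proof
  assume eq: "\<forall>x\<in>{0<..<1}. \<phi> g x = \<phi> h x"
  have "inv h \<otimes> g = \<one>"
    by (rule faithful) (use assms eq in \<open>auto simp: act_mult act_inv\<close>)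
  then show "g = h"
    using assms by (metis inv_closed inv_equality inv_inv)
qed simp

lemma commutes_iff:
  assumes "g \<in> carrier G" "h \<in> carrier G"
  shows "commutes G g h \<longleftrightarrow> (\<forall>x\<in>{0<..<1}. \<phi> g (\<phi> h x) = \<phi> h (\<phi> g x))"
  unfolding commutes_def using assms by (subst eq_iff_act_eq) (auto simp: act_mult)

lemma commutes_inv:
  assumes "a \<in> carrier G" "g \<in> carrier G" "commutes G a g"
  shows "commutes G (inv a) g"
  unfolding commutes_iff[OF inv_closed[OF assms(1)] assms(2)]
proof
  fix x :: real assume x: "x \<in> {0<..<1}"
  have ax: "\<phi> (inv a) x \<in> {0<..<1}" and gx: "\<phi> g x \<in> {0<..<1}"
    using x assms act_closed by blast+
  then have "\<phi> a (\<phi> g (\<phi> (inv a) x)) = \<phi> g x"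
    using assms commutes_iff act_inv2[OF assms(1) x] by metis
  then show "\<phi> (inv a) (\<phi> g x) = \<phi> g (\<phi> (inv a) x)"
    using act_inv[OF assms(1) act_closed[OF assms(2) ax]] by simp
qed

lemma commutes_mult:
  assumes "a \<in> carrier G" "b \<in> carrier G" "g \<in> carrier G" "commutes G a g" "commutes G b g"
  shows "commutes G (a \<otimes> b) g"
  using assms unfolding commutes_def by (metis m_assoc)

lemma act_commutator:
  assumes "a \<in> carrier G" "b \<in> carrier G" "x \<in> {0<..<1}"
  shows "\<phi> (commutator G a b) x = \<phi> a (\<phi> b (\<phi> (inv a) (\<phi> (inv b) x)))"
proof -
  have "\<phi> (inv b) x \<in> {0<..<1}" using assms act_closed by blast
  moreover from this have "\<phi> (inv a) (\<phi> (inv b) x) \<in> {0<..<1}" using assms act_closed by blast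
  ultimately show ?thesis
    using assms by (simp add: commutator_def act_mult)
qed

section \<open>Supports and displaced neighbourhoods\<close>

definition moved :: "'a \<Rightarrow> real set" where
  "moved g = {x \<in> {0<..<1}. \<phi> g x \<noteq> x}"

lemma moved_subset: "moved g \<subseteq> {0<..<1}"
  by (auto simp: moved_def)

lemma moved_inv [simp]:
  assumes "g \<in> carrier G"
  shows "moved (inv g) = moved g"
  using assms act_inv_eq_iff[OF assms] by (auto simp: moved_def)

lemma act_fixed: "x \<in> {0<..<1} \<Longrightarrow> x \<notin> moved g \<Longrightarrow> \<phi> g x = x"
  by (simp add: moved_def)

lemma act_inv_fixed: "g \<in> carrier G \<Longrightarrow> x \<in> {0<..<1} \<Longrightarrow> x \<notin> moved g \<Longrightarrow> \<phi> (inv g) x = x"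
  using act_fixed[of x "inv g"] by simp

lemma act_moved_iff:
  assumes "g \<in> carrier G" "x \<in> {0<..<1}"
  shows "\<phi> g x \<in> moved g \<longleftrightarrow> x \<in> moved g"
  using assms act_closed by (auto simp: moved_def act_inject)

lemma moved_conj_iff:
  assumes "g \<in> carrier G" "k \<in> carrier G" "x \<in> {0<..<1}"
  shows "x \<in> moved (k \<otimes> g \<otimes> inv k) \<longleftrightarrow> \<phi> (inv k) x \<in> moved g"
proof -
  define y where "y = \<phi> (inv k) x"
  have y: "y \<in> {0<..<1}" "\<phi> k y = x" using assms act_closed act_inv2 by (auto simp: y_def)
  then have "\<phi> g y \<in> {0<..<1}" using assms act_closed by blast
  then have "\<phi> k (\<phi> g y) = x \<longleftrightarrow> \<phi> g y = y"
    using act_inject[OF assms(2) _ y(1)] y(2) by simp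
  then show ?thesis
    using assms y by (simp add: moved_def act_mult flip: y_def)
qed

lemma moved_nonempty:
  assumes "g \<in> carrier G" "g \<noteq> \<one>"
  shows "moved g \<noteq> {}"
  using faithful[OF assms(1)] assms(2) by (auto simp: moved_def)

lemma funpow_act_closed:
  "g \<in> carrier G \<Longrightarrow> x \<in> {0<..<1} \<Longrightarrow> (\<phi> g ^^ n) x \<in> {0<..<1}"
  using act_closed by (induction n) auto

lemma funpow_act_commute:
  assumes "g \<in> carrier G" "h \<in> carrier G" "commutes G h g" "x \<in> {0<..<1}"
  shows "\<phi> h ((\<phi> g ^^ n) x) = (\<phi> g ^^ n) (\<phi> h x)"
proof (induction n)
  case (Suc n)
  then show ?case
    using assms funpow_act_closed[OF assms(1,4)] by (simp add: commutes_iff)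
qed simp

lemma funpow_act_inv:
  "g \<in> carrier G \<Longrightarrow> x \<in> {0<..<1} \<Longrightarrow> (\<phi> (inv g) ^^ n) ((\<phi> g ^^ n) x) = x"
proof (induction n arbitrary: x)
  case (Suc n)
  have "(\<phi> (inv g) ^^ Suc n) ((\<phi> g ^^ Suc n) x) = (\<phi> (inv g) ^^ n) (\<phi> (inv g) (\<phi> g ((\<phi> g ^^ n) x)))"
    by (subst funpow_Suc_right) simp
  then show ?case
    using Suc by (simp only: act_inv funpow_act_closed)
qed simp

text \<open>With \<open>x < q < r < \<phi> g x\<close> and \<open>p\<close> the preimage of
  \<open>r\<close>, every point above \<open>p\<close> is sent above \<open>q\<close>. Since
  \<open>p < q\<close>, it then stays above \<open>q\<close> under all further iterates.\<close>

lemma wandering_nbhd_aux: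
  assumes g: "g \<in> carrier G" and x: "x \<in> {0<..<1}" "x < \<phi> g x"
  obtains p q where "p \<in> {0<..<1}" "q \<in> {0<..<1}" "p < x" "x < q"
    "\<And>n v. v \<in> {p<..<q} \<Longrightarrow> (\<phi> g ^^ Suc n) v \<notin> {p<..<q}"
proof -
  have gx: "\<phi> g x \<in> {0<..<1}" using g x act_closed by blast
  obtain q where q: "x < q" "q < \<phi> g x" using dense x by blast
  obtain r where r: "q < r" "r < \<phi> g x" using dense q by blast
  have qr: "q \<in> {0<..<1}" "r \<in> {0<..<1}" using q r gx x by auto
  define p where "p = \<phi> (inv g) r"
  have p: "p \<in> {0<..<1}" "\<phi> g p = r" "p < x"
    using qr g act_closed act_inv2 act_inv_less_iff x r by (auto simp: p_def)
  have up: "q < \<phi> g z" if "p < z" "z \<in> {0<..<1}" for z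
    using act_mono[OF g p(1) that(2,1)] p r by simp
  have "q < (\<phi> g ^^ Suc n) v" if v: "v \<in> {p<..<q}" for n v
  proof (induction n)
    case 0
    then show ?case using up[of v] v p qr by auto
  next
    case (Suc n)
    have "v \<in> {0<..<1}" using v p qr by auto
    then show ?case using up[OF _ funpow_act_closed[OF g, of v "Suc n"]] Suc p q by simp
  qed
  then show thesis
    using that[OF p(1) qr(1) p(3) q(1)] by (meson greaterThanLessThan_iff less_asym)
qed

text \<open>If \<open>g\<close> pushes \<open>x\<close> down, its inverse pushes \<open>x\<close>
  up, and a return to the window under an iterate of \<open>g\<close>, read backwards, is a return
  under the same iterate of the inverse.\<close>

lemma wandering_nbhd:
  assumes g: "g \<in> carrier G" and x: "x \<in> moved g"
  obtains p q where "p \<in> {0<..<1}" "q \<in> {0<..<1}" "p < x" "x < q"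
    "\<And>n v. v \<in> {p<..<q} \<Longrightarrow> (\<phi> g ^^ Suc n) v \<notin> {p<..<q}"
proof (cases "x < \<phi> g x")
  case True
  then show thesis using wandering_nbhd_aux[OF g _ True] x that by (auto simp: moved_def)
next
  case False
  then have "x \<in> {0<..<1}" "\<phi> g x < x" using x by (auto simp: moved_def)
  then have "x < \<phi> (inv g) x" using less_act_inv_iff[OF g] by blast
  then obtain p q where pq: "p \<in> {0<..<1}" "q \<in> {0<..<1}" "p < x" "x < q"
    and w: "\<And>n v. v \<in> {p<..<q} \<Longrightarrow> (\<phi> (inv g) ^^ Suc n) v \<notin> {p<..<q}"
    using wandering_nbhd_aux[of "inv g" x] g \<open>x \<in> {0<..<1}\<close> by blast
  have "(\<phi> g ^^ Suc n) v \<notin> {p<..<q}" if v: "v \<in> {p<..<q}" for n v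
  proof
    assume "(\<phi> g ^^ Suc n) v \<in> {p<..<q}"
    then have "(\<phi> (inv g) ^^ Suc n) ((\<phi> g ^^ Suc n) v) \<notin> {p<..<q}" by (rule w)
    moreover have "v \<in> {0<..<1}" using v pq by auto
    ultimately show False using funpow_act_inv[OF g, of v "Suc n"] v by simp
  qed
  then show thesis using that[OF pq] by blast
qed

lemma displaced_nbhd:
  assumes g: "g \<in> carrier G" and x: "x \<in> moved g"
  obtains p q where "p \<in> {0<..<1}" "q \<in> {0<..<1}" "p < x" "x < q"
    "\<And>v. v \<in> {p<..<q} \<Longrightarrow> \<phi> g v \<notin> {p<..<q}" "{p<..<q} \<subseteq> moved g"
proof -
  obtain p q where pq: "p \<in> {0<..<1}" "q \<in> {0<..<1}" "p < x" "x < q"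
    and w: "\<And>n v. v \<in> {p<..<q} \<Longrightarrow> (\<phi> g ^^ Suc n) v \<notin> {p<..<q}"
    by (rule wandering_nbhd[OF g x]) auto
  have d: "\<phi> g v \<notin> {p<..<q}" if "v \<in> {p<..<q}" for v using w[OF that, of 0] by simp
  moreover have "{p<..<q} \<subseteq> moved g"
  proof
    fix v assume v: "v \<in> {p<..<q}"
    then show "v \<in> moved g" using d[OF v] pq by (auto simp: moved_def)
  qed
  ultimately show thesis using that[OF pq] by blast
qed

lemma open_moved:
  assumes "g \<in> carrier G"
  shows "open (moved g)"
proof (subst open_subopen, intro ballI)
  fix x assume "x \<in> moved g"
  then obtain p q where "p < x" "x < q" "{p<..<q} \<subseteq> moved g"
    using displaced_nbhd[OF assms] by metis
  then show "\<exists>T. open T \<and> x \<in> T \<and> T \<subseteq> moved g" by (intro exI[of _ "{p<..<q}"]) auto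
qed

end

text \<open>The prescribed point itself must be moved, which is more than a nontrivial element
  supported in the window. Here \<open>p\<close> and \<open>q\<close> are arbitrary reals, so the
  window may stick out of the unit interval.\<close>

locale locally_moving_action = interval_action +
  assumes locally_moving: "p < x \<Longrightarrow> x < q \<Longrightarrow> x \<in> {0<..<1} \<Longrightarrow>
    \<exists>k\<in>carrier G. x \<in> moved k \<and> moved k \<subseteq> {p<..<q}"
begin

section \<open>Algebraic characterization of disjoint supports\<close>

lemma commutes_if_disjoint_moved:
  assumes "f \<in> carrier G" "g \<in> carrier G" "moved f \<inter> moved g = {}"
  shows "commutes G f g"
  unfolding commutes_iff[OF assms(1,2)]
proof
  fix x :: real assume x: "x \<in> {0<..<1}"
  have fx: "\<phi> f x \<in> {0<..<1}" and gx: "\<phi> g x \<in> {0<..<1}" using assms x act_closed by blast+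
  show "\<phi> f (\<phi> g x) = \<phi> g (\<phi> f x)"
  proof (cases "x \<in> moved f")
    case True
    then have "x \<notin> moved g" "\<phi> f x \<notin> moved g"
      using act_moved_iff[OF assms(1) x] assms(3) by blast+
    then show ?thesis using x fx by (simp add: act_fixed)
  next
    case False
    moreover have "\<phi> g x \<notin> moved f"
      using act_moved_iff[OF assms(2) x] assms(3) False act_fixed[OF x, of g] by (metis disjoint_iff)
    ultimately show ?thesis using x gx by (simp add: act_fixed)
  qed
qed

text \<open>Noncommuting \<open>f\<close> and \<open>h\<close> move a common point \<open>y\<close>.
  Choose \<open>V\<close> around \<open>y\<close> inside the support of \<open>f\<close> and
  displaced by \<open>h\<close>, then \<open>b\<close> supported in \<open>V\<close>, then
  \<open>a\<close> supported in a smaller window displaced by \<open>b\<close>, both moving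
  \<open>y\<close>. The double commutator is nontrivial and supported in \<open>V\<close>, hence
  away from the support of \<open>g\<close>.\<close>

lemma algebraically_disjoint_if:
  assumes f: "f \<in> carrier G" and g: "g \<in> carrier G" and disj: "moved f \<inter> moved g = {}"
  shows "algebraically_disjoint G f g"
  unfolding algebraically_disjoint_def
proof (intro ballI impI)
  fix h assume h: "h \<in> carrier G" and nc: "\<not> commutes G f h"
  obtain y where y: "y \<in> moved f" "y \<in> moved h"
    using nc commutes_if_disjoint_moved[OF f h] by blast
  obtain p1 q1 where 1: "p1 < y" "y < q1" "{p1<..<q1} \<subseteq> moved f"
    using displaced_nbhd[OF f y(1)] by metis
  obtain p2 q2 where 2: "p2 < y" "y < q2" "\<And>v. v \<in> {p2<..<q2} \<Longrightarrow> \<phi> h v \<notin> {p2<..<q2}"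
    using displaced_nbhd[OF h y(2)] by metis
  define V where "V = {max p1 p2<..<min q1 q2}"
  have yV: "y \<in> V" and yI: "y \<in> {0<..<1}" using 1 2 y moved_subset[of f] by (auto simp: V_def)
  have Vf: "V \<subseteq> moved f" and Vh: "\<And>v. v \<in> V \<Longrightarrow> \<phi> h v \<notin> V"
    using 1 2 by (auto simp: V_def)
  have VI: "V \<subseteq> {0<..<1}" using Vf moved_subset by blast
  obtain b where b: "b \<in> carrier G" "y \<in> moved b" "moved b \<subseteq> V"
    using locally_moving[of "max p1 p2" y "min q1 q2"] 1 2 yI by (auto simp: V_def)
  obtain p q where 3: "p < y" "y < q" "\<And>v. v \<in> {p<..<q} \<Longrightarrow> \<phi> b v \<notin> {p<..<q}"
    "{p<..<q} \<subseteq> moved b"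
    using displaced_nbhd[OF b(1,2)] by metis
  obtain a where a: "a \<in> carrier G" "y \<in> moved a" "moved a \<subseteq> {p<..<q}"
    using locally_moving[OF 3(1,2) yI] by blast
  have aV: "moved a \<subseteq> V" using a 3 b by blast
  define w where "w = commutator G b h"
  have w: "w \<in> carrier G" using b h by (simp add: w_def)
  \<comment> \<open>Here w = b (h b^-1 h^-1), and the second factor is supported in the image of
    \<open>V\<close> under \<open>h\<close>, which misses \<open>V\<close>.\<close>
  have wV: "\<phi> w v = \<phi> b v" if v: "v \<in> V" for v
  proof -
    have vI: "v \<in> {0<..<1}" using v VI by blast
    have hv: "\<phi> (inv h) v \<in> {0<..<1}" using act_closed h vI by simp
    have "\<phi> (inv h) v \<notin> V" using Vh[of "\<phi> (inv h) v"] act_inv2[OF h vI] v by auto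
    then have "\<phi> (inv b) (\<phi> (inv h) v) = \<phi> (inv h) v"
      using act_inv_fixed[OF b(1) hv] b(3) by blast
    then show ?thesis
      using act_commutator[OF b(1) h vI] act_inv2[OF h vI] by (simp add: w_def)
  qed
  define c where "c = commutator G a w"
  have c: "c \<in> carrier G" using a w by (simp add: c_def)
  have bV: "\<phi> b v \<in> V" if "v \<in> V" for v
  proof (cases "v \<in> moved b")
    case True
    then show ?thesis using act_moved_iff[OF b(1)] that VI b(3) by blast
  next
    case False
    then show ?thesis using that VI by (auto simp: moved_def)
  qed
  \<comment> \<open>Write c = a (w a^-1 w^-1). If w^-1 z is moved by \<open>a\<close>, it lies in
    \<open>V\<close>, where \<open>w\<close> acts as \<open>b\<close> and preserves
    \<open>V\<close>; otherwise the second factor fixes \<open>z\<close> and \<open>c\<close> acts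
    there as \<open>a\<close>.\<close>
  have "moved c \<subseteq> V"
  proof
    fix z assume z: "z \<in> moved c"
    then have zI: "z \<in> {0<..<1}" using moved_subset by blast
    then have wz: "\<phi> (inv w) z \<in> {0<..<1}" using act_closed w by simp
    show "z \<in> V"
    proof (cases "\<phi> (inv w) z \<in> moved a")
      case True
      then have wzV: "\<phi> (inv w) z \<in> V" using aV by blast
      then have "z = \<phi> b (\<phi> (inv w) z)"
        using wV[OF wzV] act_inv2[OF w zI] by simp
      then show ?thesis using bV[OF wzV] by simp
    next
      case False
      then have "\<phi> (inv a) (\<phi> (inv w) z) = \<phi> (inv w) z"
        using act_inv_fixed[OF a(1) wz] by simp
      then have "\<phi> c z = \<phi> a z"
        using act_commutator[OF a(1) w zI] act_inv2[OF w zI] by (simp add: c_def)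
      then show ?thesis using z aV zI by (auto simp: moved_def)
    qed
  qed
  then have "commutes G c g" using commutes_if_disjoint_moved[OF c g] disj Vf by blast
  moreover have "commutes G a g" "commutes G b g"
    using commutes_if_disjoint_moved[OF _ g] a b aV disj Vf by blast+
  \<comment> \<open>Tested at \<open>y\<close>: \<open>w\<close> sends \<open>y\<close> to
    \<open>\<phi> b y\<close>, which \<open>a\<close> fixes, while it sends
    \<open>\<phi> a y\<close> to \<open>\<phi> b (\<phi> a y)\<close>. Equality would force
    \<open>a\<close> to fix \<open>y\<close>.\<close>
  moreover have "\<not> commutes G a w"
  proof
    assume "commutes G a w"
    then have eq: "\<phi> a (\<phi> w y) = \<phi> w (\<phi> a y)" using commutes_iff[OF a(1) w] yI by blast
    have b_y: "\<phi> b y \<in> {0<..<1}" using act_closed b yI by blast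
    have "\<phi> a y \<in> V" using act_moved_iff[OF a(1) yI] a aV by blast
    moreover have "\<phi> b y \<notin> moved a"
    proof
      assume "\<phi> b y \<in> moved a"
      then have "\<phi> b y \<in> {p<..<q}" using a(3) by blast
      then show False using 3(3)[of y] 3(1,2) by simp
    qed
    ultimately have "\<phi> b y = \<phi> b (\<phi> a y)"
      using eq wV yV b_y by (auto simp: moved_def)
    then show False
      using act_inject[OF b(1) yI act_closed[OF a(1) yI]] a(2) by (auto simp: moved_def)
  qed
  ultimately show "\<exists>a\<in>carrier G. \<exists>b\<in>carrier G. commutes G a g \<and> commutes G b g \<and>
      \<not> commutes G a (commutator G b h) \<and>
      commutes G (commutator G a (commutator G b h)) g"
    using a(1) b(1) unfolding c_def w_def by blast
qed

text \<open>Since [a, b] = (a b a^-1) b^-1, the support lies in the union of that of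
  \<open>b\<close> and its translate by \<open>a\<close>.\<close>

lemma moved_commutator:
  assumes "a \<in> carrier G" "b \<in> carrier G" "z \<in> moved (commutator G a b)"
  shows "z \<in> moved b \<or> \<phi> (inv a) z \<in> moved b"
proof (rule ccontr)
  have z: "z \<in> {0<..<1}" using assms(3) moved_subset by blast
  have az: "\<phi> (inv a) z \<in> {0<..<1}" using act_closed assms(1) z by simp
  assume "\<not> ?thesis"
  then have "\<phi> (inv b) z = z" "\<phi> b (\<phi> (inv a) z) = \<phi> (inv a) z"
    using act_inv_fixed[OF assms(2) z] act_fixed[OF az] by simp_all
  then have "\<phi> (commutator G a b) z = z"
    using act_commutator[OF assms(1,2) z] act_inv2[OF assms(1) z] by simp
  then show False using assms(3) by (simp add: moved_def)
qed

text \<open>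
  If \<open>x\<close> is moved by both \<open>f\<close> and \<open>g\<close>, take \<open>h\<close> supported in a small \<open>V \<ni> x\<close>. Then
  \<open>[a, [b, h]]\<close> is supported in four translates of \<open>V\<close> by elements commuting with \<open>g\<close>. Each of
  them contains at most one point of any \<open>g\<close>-orbit, but a \<open>g\<close>-invariant support contains
  infinite orbits.
\<close>

lemma disjoint_if_algebraically_disjoint:
  assumes f: "f \<in> carrier G" and g: "g \<in> carrier G" and ad: "algebraically_disjoint G f g"
  shows "moved f \<inter> moved g = {}"
proof (rule ccontr)
  assume "moved f \<inter> moved g \<noteq> {}"
  then obtain x where x: "x \<in> moved f" "x \<in> moved g" by blast
  then have xI: "x \<in> {0<..<1}" using moved_subset by blast
  obtain p1 q1 where 1: "p1 < x" "x < q1" "\<And>v. v \<in> {p1<..<q1} \<Longrightarrow> \<phi> f v \<notin> {p1<..<q1}"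
    using displaced_nbhd[OF f x(1)] by metis
  obtain p2 q2 where 2: "p2 \<in> {0<..<1}" "q2 \<in> {0<..<1}" "p2 < x" "x < q2"
    "\<And>n v. v \<in> {p2<..<q2} \<Longrightarrow> (\<phi> g ^^ Suc n) v \<notin> {p2<..<q2}"
    by (rule wandering_nbhd[OF g x(2)]) auto
  define V where "V = {max p1 p2<..<min q1 q2}"
  have Vf: "\<And>v. v \<in> V \<Longrightarrow> \<phi> f v \<notin> V" using 1 by (auto simp: V_def)
  have Vg: "(\<phi> g ^^ Suc n) v \<notin> V" if "v \<in> V" for n v
    using 2(5)[of v n] that by (auto simp: V_def)
  have VI: "V \<subseteq> {0<..<1}" using 2 by (auto simp: V_def)
  obtain h where h: "h \<in> carrier G" "x \<in> moved h" "moved h \<subseteq> V"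
    using locally_moving[of "max p1 p2" x "min q1 q2"] 1 2 xI by (auto simp: V_def)
  have "\<not> commutes G f h"
  proof
    assume "commutes G f h"
    then have "\<phi> f (\<phi> h x) = \<phi> h (\<phi> f x)" using commutes_iff[OF f h(1)] xI by blast
    moreover have "\<phi> f x \<notin> moved h" using Vf[of x] h by blast
    ultimately have "\<phi> f (\<phi> h x) = \<phi> f x" using act_closed[OF f xI] by (auto simp: moved_def)
    then show False
      using act_inject[OF f act_closed[OF h(1) xI] xI] h(2) by (auto simp: moved_def)
  qed
  then obtain a b where a: "a \<in> carrier G" "commutes G a g" and b: "b \<in> carrier G" "commutes G b g"
    and naw: "\<not> commutes G a (commutator G b h)"
    and cg: "commutes G (commutator G a (commutator G b h)) g"
    using ad h(1) unfolding algebraically_disjoint_def by blast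
  define w where "w = commutator G b h"
  define c where "c = commutator G a w"
  have w: "w \<in> carrier G" using b h by (simp add: w_def)
  have c: "c \<in> carrier G" using a w by (simp add: c_def)
  have "\<exists>s. s \<in> moved c"
  proof (rule ccontr)
    assume none: "\<nexists>s. s \<in> moved c"
    have "\<phi> a (\<phi> w t) = \<phi> w (\<phi> a t)" if t: "t \<in> {0<..<1}" for t
    proof -
      have wa: "\<phi> w (\<phi> a t) \<in> {0<..<1}" using act_closed w a t by blast
      have "\<phi> c (\<phi> w (\<phi> a t)) = \<phi> a (\<phi> w t)"
        using act_commutator[OF a(1) w wa] act_inv[OF w act_closed[OF a(1) t]] act_inv[OF a(1) t]
        by (simp add: c_def)
      then show ?thesis using none wa by (auto simp: moved_def)
    qed
    then show False using naw commutes_iff[OF a(1) w] by (simp add: w_def)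
  qed
  then obtain s where s: "s \<in> moved c" by blast
  have sI: "s \<in> {0<..<1}" using s moved_subset by blast
  have orbit: "(\<phi> g ^^ n) s \<in> moved c" for n
  proof -
    have "\<phi> c ((\<phi> g ^^ n) s) = (\<phi> g ^^ n) (\<phi> c s)"
      using funpow_act_commute[OF g c _ sI] cg by (simp add: c_def w_def)
    moreover have "(\<phi> g ^^ n) (\<phi> c s) \<noteq> (\<phi> g ^^ n) s"
      using s funpow_act_inv[OF g sI, of n] funpow_act_inv[OF g act_closed[OF c sI], of n]
      by (metis (mono_tags, lifting) mem_Collect_eq moved_def)
    ultimately show ?thesis
      using funpow_act_closed[OF g sI, of n] by (simp add: moved_def)
  qed
  have ia: "commutes G (inv a) g" and ib: "commutes G (inv b) g"
    using commutes_inv a b g by blast+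
  \<comment> \<open>Two uses of \<open>moved_commutator\<close> cover the support of
    \<open>c\<close> by the translates of \<open>V\<close> under 1, a, b and ab; \<open>U\<close>
    holds the inverses of these elements. As they commute with \<open>g\<close>, two visits of the
    orbit to one translate amount to a return to \<open>V\<close>.\<close>
  define U where "U = {\<one>, inv a, inv b, inv b \<otimes> inv a}"
  have UC: "u \<in> carrier G" if "u \<in> U" for u using that a b by (auto simp: U_def)
  have Ug: "commutes G u g" if "u \<in> U" for u
    using that ia ib commutes_mult[OF inv_closed inv_closed g ib ia] a b g by (auto simp: U_def commutes_def)
  have cover: "\<exists>u\<in>U. \<phi> u z \<in> V" if z: "z \<in> moved c" for z
  proof -
    have zI: "z \<in> {0<..<1}" using z moved_subset by blast
    obtain z' where z': "z' = z \<or> z' = \<phi> (inv a) z" "z' \<in> moved w"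
      using moved_commutator[OF a(1) w] z by (auto simp: c_def)
    then have "z' \<in> V \<or> \<phi> (inv b) z' \<in> V"
      using moved_commutator[OF b(1) h(1)] h(3) by (auto simp: w_def)
    then show ?thesis using z' zI a b by (auto simp: U_def act_one act_mult)
  qed
  have "\<exists>u\<in>U. infinite {n\<in>UNIV. \<phi> u ((\<phi> g ^^ n) s) \<in> V}"
  proof (rule pigeonhole_infinite_rel[OF infinite_UNIV_nat])
    show "finite U" by (simp add: U_def)
    show "\<forall>n\<in>UNIV. \<exists>u\<in>U. \<phi> u ((\<phi> g ^^ n) s) \<in> V" using cover orbit by blast
  qed
  then obtain u where u: "u \<in> U" and inf: "infinite {n. \<phi> u ((\<phi> g ^^ n) s) \<in> V}" by auto
  have "\<exists>m. \<phi> u ((\<phi> g ^^ m) s) \<in> V"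
    using inf by (rule contrapos_np) simp
  then obtain m where m: "\<phi> u ((\<phi> g ^^ m) s) \<in> V" ..
  have "\<exists>n>m. n \<in> {n. \<phi> u ((\<phi> g ^^ n) s) \<in> V}"
    using inf unfolding infinite_nat_iff_unbounded by blast
  then obtain n where n: "n > m" "\<phi> u ((\<phi> g ^^ n) s) \<in> V" by blast
  obtain k where k: "n = Suc k + m" using n(1) by (metis add.commute add_Suc_right less_imp_Suc_add)
  have "\<phi> u ((\<phi> g ^^ n) s) = (\<phi> g ^^ Suc k) (\<phi> u ((\<phi> g ^^ m) s))"
    using funpow_act_commute[OF g UC[OF u] Ug[OF u] funpow_act_closed[OF g sI, of m], of "Suc k"]
    unfolding k funpow_add by simp
  then show False using Vg[OF m, of k] n(2) by simp
qed

lemma algebraically_disjoint_iff: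
  assumes "f \<in> carrier G" "g \<in> carrier G"
  shows "algebraically_disjoint G f g \<longleftrightarrow> moved f \<inter> moved g = {}"
  using algebraically_disjoint_if[OF assms] disjoint_if_algebraically_disjoint[OF assms] by blast

end

section \<open>Minimal actions and germs at the endpoints\<close>

context interval_action
begin

text \<open>Conjugation by x -> 1 - x reverses the order twice, so the action stays increasing.
  Statements about the end 1 thereby reduce to those about 0.\<close>

lemma interval_action_reflect: "interval_action G (\<lambda>g x. 1 - \<phi> g (1 - x))"
proof
  fix g h and x y :: real
  assume g: "g \<in> carrier G" and x: "x \<in> {0<..<1}"
  then have x': "1 - x \<in> {0<..<1}" by auto
  show "1 - \<phi> g (1 - x) \<in> {0<..<1}" using act_closed[OF g x'] by simp
  show "1 - \<phi> (g \<otimes> h) (1 - x) = 1 - \<phi> g (1 - (1 - \<phi> h (1 - x)))" if "h \<in> carrier G"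
    using act_mult[OF g that x'] by simp
  show "1 - \<phi> g (1 - x) < 1 - \<phi> g (1 - y)" if "y \<in> {0<..<1}" "x < y"
    using act_mono[OF g _ x', of "1 - y"] that by simp
next
  fix g assume g: "g \<in> carrier G" and fixed: "\<And>x. x \<in> {0<..<1} \<Longrightarrow> 1 - \<phi> g (1 - x) = x"
  show "g = \<one>"
  proof (rule faithful[OF g])
    fix x :: real assume "x \<in> {0<..<1}"
    then show "\<phi> g x = x" using fixed[of "1 - x"] by simp
  qed
qed

text \<open>Equality of the germs at 0 of the two products; a relation on pairs avoids constructing
  the group of germs.\<close>

definition commutes_near_0 :: "'a \<Rightarrow> 'a \<Rightarrow> bool" where
  "commutes_near_0 a b \<longleftrightarrow>
    (\<exists>\<epsilon>\<in>{0<..<1}. \<forall>t\<in>{0<..<1}. t < \<epsilon> \<longrightarrow> \<phi> a (\<phi> b t) = \<phi> b (\<phi> a t))"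

definition commutes_near_1 :: "'a \<Rightarrow> 'a \<Rightarrow> bool" where
  "commutes_near_1 a b \<longleftrightarrow>
    (\<exists>\<epsilon>\<in>{0<..<1}. \<forall>t\<in>{0<..<1}. \<epsilon> < t \<longrightarrow> \<phi> a (\<phi> b t) = \<phi> b (\<phi> a t))"

lemma commutes_near_1_reflect:
  "commutes_near_1 = interval_action.commutes_near_0 (\<lambda>g x. 1 - \<phi> g (1 - x))"
proof (intro ext)
  fix a b
  interpret R: interval_action G "\<lambda>g x. 1 - \<phi> g (1 - x)" by (rule interval_action_reflect)
  have refl: "(\<exists>\<epsilon>\<in>{0<..<1}. \<forall>t\<in>{0<..<1}. \<epsilon> < t \<longrightarrow> P t) \<longleftrightarrow>
    (\<exists>\<epsilon>\<in>{0<..<1}. \<forall>t\<in>{0<..<1}. t < \<epsilon> \<longrightarrow> P (1 - t))" for P :: "real \<Rightarrow> bool"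
  proof (safe)
    fix e :: real assume e: "e \<in> {0<..<1}" "\<forall>t\<in>{0<..<1}. e < t \<longrightarrow> P t"
    show "\<exists>\<epsilon>\<in>{0<..<1}. \<forall>t\<in>{0<..<1}. t < \<epsilon> \<longrightarrow> P (1 - t)"
      by (rule bexI[of _ "1 - e"]) (use e in auto)
  next
    fix e :: real assume e: "e \<in> {0<..<1}" "\<forall>t\<in>{0<..<1}. t < e \<longrightarrow> P (1 - t)"
    have "P t" if "t \<in> {0<..<1}" "1 - e < t" for t
      using e(2)[rule_format, of "1 - t"] that by simp
    then show "\<exists>\<epsilon>\<in>{0<..<1}. \<forall>t\<in>{0<..<1}. \<epsilon> < t \<longrightarrow> P t"
      by (intro bexI[of _ "1 - e"]) (use e in auto)
  qed
  show "commutes_near_1 a b = R.commutes_near_0 a b"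
    unfolding commutes_near_1_def R.commutes_near_0_def by (subst refl) simp
qed

lemma commutes_near_0_sym: "commutes_near_0 a b \<Longrightarrow> commutes_near_0 b a"
  unfolding commutes_near_0_def by metis

lemma commutes_near_0_inv:
  assumes a: "a \<in> carrier G" and b: "b \<in> carrier G" and ab: "commutes_near_0 a b"
  shows "commutes_near_0 (inv a) b"
proof -
  obtain e where e: "e \<in> {0<..<1}" "\<And>t. t \<in> {0<..<1} \<Longrightarrow> t < e \<Longrightarrow> \<phi> a (\<phi> b t) = \<phi> b (\<phi> a t)"
    using ab unfolding commutes_near_0_def by blast
  have "\<phi> (inv a) (\<phi> b t) = \<phi> b (\<phi> (inv a) t)" if t: "t \<in> {0<..<1}" "t < \<phi> a e" for t
  proof -
    have s: "\<phi> (inv a) t \<in> {0<..<1}" using act_closed a t by simp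
    have "\<phi> (inv a) t < e" using act_inv_less_iff[OF a t(1) e(1)] t by simp
    then have "\<phi> a (\<phi> b (\<phi> (inv a) t)) = \<phi> b t" using e(2)[OF s] act_inv2[OF a t(1)] by simp
    then show ?thesis using act_inv[OF a act_closed[OF b s]] by simp
  qed
  then show ?thesis using act_closed[OF a e(1)] unfolding commutes_near_0_def by blast
qed

lemma commutes_near_0_mult:
  assumes C: "a \<in> carrier G" "b \<in> carrier G" "c \<in> carrier G"
    and ac: "commutes_near_0 a c" and bc: "commutes_near_0 b c"
  shows "commutes_near_0 (a \<otimes> b) c"
proof -
  obtain e where e: "e \<in> {0<..<1}" "\<And>t. t \<in> {0<..<1} \<Longrightarrow> t < e \<Longrightarrow> \<phi> a (\<phi> c t) = \<phi> c (\<phi> a t)"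
    using ac unfolding commutes_near_0_def by blast
  obtain d where d: "d \<in> {0<..<1}" "\<And>t. t \<in> {0<..<1} \<Longrightarrow> t < d \<Longrightarrow> \<phi> b (\<phi> c t) = \<phi> c (\<phi> b t)"
    using bc unfolding commutes_near_0_def by blast
  define r where "r = min d (\<phi> (inv b) e)"
  have "\<phi> (inv b) e \<in> {0<..<1}" using act_closed C e by simp
  then have "r \<in> {0<..<1}" using d by (auto simp: r_def)
  moreover have "\<phi> (a \<otimes> b) (\<phi> c t) = \<phi> c (\<phi> (a \<otimes> b) t)" if t: "t \<in> {0<..<1}" "t < r" for t
  proof -
    have bt: "\<phi> b t \<in> {0<..<1}" and ct: "\<phi> c t \<in> {0<..<1}" using C t act_closed by blast+
    have "\<phi> b t < e" using t less_act_inv_iff[OF C(2) e(1) t(1)] by (simp add: r_def)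
    then show ?thesis using e(2)[OF bt] d(2)[OF t(1)] t ct C by (simp add: act_mult r_def)
  qed
  ultimately show ?thesis unfolding commutes_near_0_def by blast
qed

text \<open>For fixed \<open>c\<close>, the elements whose germs commute with that of
  \<open>c\<close> form a subgroup. This is used first with \<open>c\<close> in \<open>S\<close> and
  then, after exchanging the roles by symmetry, with \<open>c = b\<close>.\<close>

lemma commutes_near_0_generate:
  assumes S: "S \<subseteq> carrier G" and comm: "\<And>a b. a \<in> S \<Longrightarrow> b \<in> S \<Longrightarrow> commutes_near_0 a b"
    and a: "a \<in> generate G S" and b: "b \<in> generate G S"
  shows "commutes_near_0 a b"
proof -
  have gen: "commutes_near_0 x c"
    if x: "x \<in> generate G S" and c: "c \<in> carrier G" "\<And>y. y \<in> S \<Longrightarrow> commutes_near_0 y c" for x c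
    using x
  proof (induction rule: generate.induct)
    case one
    have "\<phi> \<one> (\<phi> c t) = \<phi> c (\<phi> \<one> t)" if "t \<in> {0<..<1}" for t
      using that act_closed[OF c(1)] by (simp add: act_one)
    then show ?case unfolding commutes_near_0_def by (intro bexI[of _ "1/2"]) auto
  next
    case (incl h)
    then show ?case using c by blast
  next
    case (inv h)
    then show ?case using c S commutes_near_0_inv by blast
  next
    case (eng h1 h2)
    then show ?case using c commutes_near_0_mult generate_in_carrier[OF S] by blast
  qed
  have "commutes_near_0 y b" if "y \<in> S" for y
    using gen[OF b, of y] that S comm by (blast intro: commutes_near_0_sym)
  then show ?thesis using gen[OF a] generate_in_carrier[OF S b] by blast
qed

lemma commutes_near_1_generate:
  assumes "S \<subseteq> carrier G" "\<And>a b. a \<in> S \<Longrightarrow> b \<in> S \<Longrightarrow> commutes_near_1 a b"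
    and "a \<in> generate G S" "b \<in> generate G S"
  shows "commutes_near_1 a b"
proof -
  interpret R: interval_action G "\<lambda>g x. 1 - \<phi> g (1 - x)" by (rule interval_action_reflect)
  show ?thesis using assms R.commutes_near_0_generate unfolding commutes_near_1_reflect by blast
qed

lemma fixed_generate:
  assumes S: "S \<subseteq> carrier G" "\<And>f. f \<in> S \<Longrightarrow> \<phi> f t = t" and t: "t \<in> {0<..<1}"
    and g: "g \<in> generate G S"
  shows "\<phi> g t = t"
  using g
proof (induction rule: generate.induct)
  case (inv h)
  then show ?case using S act_inv[of h t] t by force
next
  case (eng h1 h2)
  then show ?case using act_mult[OF _ _ t] generate_in_carrier[OF S(1)] by simp
qed (use S t act_one in auto)

lemma commutes_near_0_if_trivial:
  assumes C: "a \<in> carrier G" "b \<in> carrier G" and r: "r \<in> {0<..<1}"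
    and triv: "\<And>t. t \<in> {0<..<1} \<Longrightarrow> t < r \<Longrightarrow> \<phi> a t = t"
  shows "commutes_near_0 a b"
proof -
  define e where "e = min r (\<phi> (inv b) r)"
  have "\<phi> (inv b) r \<in> {0<..<1}" using act_closed C r by simp
  then have "e \<in> {0<..<1}" using r by (auto simp: e_def)
  moreover have "\<phi> a (\<phi> b t) = \<phi> b (\<phi> a t)" if t: "t \<in> {0<..<1}" "t < e" for t
    using triv[OF t(1)] triv[OF act_closed[OF C(2) t(1)]] t less_act_inv_iff[OF C(2) r t(1)]
    by (simp add: e_def)
  ultimately show ?thesis unfolding commutes_near_0_def by blast
qed

lemma commutes_near_1_if_trivial:
  assumes C: "a \<in> carrier G" "b \<in> carrier G" and r: "r \<in> {0<..<1}"
    and triv: "\<And>t. t \<in> {0<..<1} \<Longrightarrow> r < t \<Longrightarrow> \<phi> a t = t"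
  shows "commutes_near_1 a b"
proof -
  interpret R: interval_action G "\<lambda>g x. 1 - \<phi> g (1 - x)" by (rule interval_action_reflect)
  have "R.commutes_near_0 a b"
  proof (rule R.commutes_near_0_if_trivial[OF C])
    show "1 - r \<in> {0<..<1}" using r by simp
    show "1 - \<phi> a (1 - t) = t" if "t \<in> {0<..<1}" "t < 1 - r" for t
      using triv[of "1 - t"] that by simp
  qed
  then show ?thesis unfolding commutes_near_1_reflect .
qed

lemma commutes_near_1_sym: "commutes_near_1 a b \<Longrightarrow> commutes_near_1 b a"
  unfolding commutes_near_1_def by metis

text \<open>With s = a^-1 b^-1 t, the commutator sends \<open>t\<close> to a b s, which equals b a s
  = t as soon as s < e. That condition on s is \<open>t < \<phi> b (\<phi> a e)\<close>, whence the
  bound.\<close>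

lemma commutator_trivial_near_0:
  assumes a: "a \<in> carrier G" and b: "b \<in> carrier G" and ab: "commutes_near_0 a b"
  shows "\<exists>u\<in>{0<..<1}. \<forall>t\<in>{0<..<1}. t < u \<longrightarrow> \<phi> (commutator G a b) t = t"
proof -
  obtain e where e: "e \<in> {0<..<1}" "\<And>t. t \<in> {0<..<1} \<Longrightarrow> t < e \<Longrightarrow> \<phi> a (\<phi> b t) = \<phi> b (\<phi> a t)"
    using ab unfolding commutes_near_0_def by blast
  have ae: "\<phi> a e \<in> {0<..<1}" using act_closed a e by blast
  have "\<phi> (commutator G a b) t = t" if t: "t \<in> {0<..<1}" "t < \<phi> b (\<phi> a e)" for t
  proof -
    have bt: "\<phi> (inv b) t \<in> {0<..<1}" using act_closed b t by simp
    then have abt: "\<phi> (inv a) (\<phi> (inv b) t) \<in> {0<..<1}" using act_closed a by simp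
    have "\<phi> (inv a) (\<phi> (inv b) t) < e"
      using act_inv_less_iff[OF a bt e(1)] act_inv_less_iff[OF b t(1) ae] t by simp
    then show ?thesis
      using e(2)[OF abt] act_commutator[OF a b t(1)] act_inv2[OF a bt] act_inv2[OF b t(1)] by simp
  qed
  then show ?thesis using act_closed[OF b ae] by blast
qed

lemma commutator_trivial_near_1:
  assumes a: "a \<in> carrier G" and b: "b \<in> carrier G" and ab: "commutes_near_1 a b"
  shows "\<exists>v\<in>{0<..<1}. \<forall>t\<in>{0<..<1}. v < t \<longrightarrow> \<phi> (commutator G a b) t = t"
proof -
  interpret R: interval_action G "\<lambda>g x. 1 - \<phi> g (1 - x)" by (rule interval_action_reflect)
  obtain u where u: "u \<in> {0<..<1}"
    "\<And>t. t \<in> {0<..<1} \<Longrightarrow> t < u \<Longrightarrow> 1 - \<phi> (commutator G a b) (1 - t) = t"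
    using R.commutator_trivial_near_0[OF a b] ab unfolding commutes_near_1_reflect by blast
  have "\<phi> (commutator G a b) t = t" if "t \<in> {0<..<1}" "1 - u < t" for t
    using u(2)[of "1 - t"] that by simp
  then show ?thesis using u(1) by (intro bexI[of _ "1 - u"]) auto
qed

lemma conj_commutator:
  assumes "a \<in> carrier G" "b \<in> carrier G" "k \<in> carrier G"
  shows "k \<otimes> commutator G a b \<otimes> inv k = commutator G (k \<otimes> a \<otimes> inv k) (k \<otimes> b \<otimes> inv k)"
proof -
  have "inv k \<otimes> (k \<otimes> x) = x" if "x \<in> carrier G" for x
    using assms that by (simp flip: m_assoc)
  then show ?thesis
    using assms by (simp add: commutator_def inv_mult_group m_assoc)
qed

lemma commutes_if_commutator_eq_one:
  assumes "a \<in> carrier G" "b \<in> carrier G" "commutator G a b = \<one>"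
  shows "commutes G a b"
  unfolding commutes_iff[OF assms(1,2)]
proof
  fix t :: real assume t: "t \<in> {0<..<1}"
  have at: "\<phi> a t \<in> {0<..<1}" using assms(1) act_closed t by blast
  have bat: "\<phi> b (\<phi> a t) \<in> {0<..<1}" using assms(2) act_closed at by blast
  show "\<phi> a (\<phi> b t) = \<phi> b (\<phi> a t)"
    using act_commutator[OF assms(1,2) bat] act_inv[OF assms(2) at] act_inv[OF assms(1) t]
      act_one[OF bat] assms(3) by simp
qed

end

section \<open>Contraction towards the endpoints\<close>

locale minimal_interval_action = interval_action +
  assumes minimal: "x \<in> {0<..<1} \<Longrightarrow> 0 \<le> p \<Longrightarrow> p < q \<Longrightarrow> q \<le> 1 \<Longrightarrow> \<exists>g\<in>carrier G. \<phi> g x \<in> {p<..<q}"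
begin

lemma minimal_interval_action_reflect: "minimal_interval_action G (\<lambda>g x. 1 - \<phi> g (1 - x))"
proof -
  interpret R: interval_action G "\<lambda>g x. 1 - \<phi> g (1 - x)" by (rule interval_action_reflect)
  show ?thesis
  proof
    fix x p q :: real assume "x \<in> {0<..<1}" "0 \<le> p" "p < q" "q \<le> 1"
    then show "\<exists>g\<in>carrier G. 1 - \<phi> g (1 - x) \<in> {p<..<q}"
      using minimal[of "1 - x" "1 - q" "1 - p"] by force
  qed
qed

text \<open>
  A conjugate of \<open>f\<close> has support \<open>(0, c)\<close> with \<open>p < c < s\<close>. Pushing down by it from the infimum
  of the reachable positions of \<open>p\<close> would lead below that infimum.
\<close>

lemma contract_to_0:
  assumes f: "f \<in> carrier G" and b: "b \<in> {0<..<1}"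
    and up: "\<And>t. t \<in> {0<..<1} \<Longrightarrow> t < b \<Longrightarrow> t < \<phi> f t"
    and fixed: "\<And>t. t \<in> {0<..<1} \<Longrightarrow> b \<le> t \<Longrightarrow> \<phi> f t = t"
    and p: "p \<in> {0<..<1}" and s: "p < s" "s \<le> 1" and u: "u \<in> {0<..<1}"
  shows "\<exists>g\<in>carrier G. (\<forall>t\<in>{0<..<1}. s \<le> t \<longrightarrow> \<phi> g t = t) \<and> \<phi> g p < u"
proof (rule ccontr)
  assume "\<not> ?thesis"
  then have far: "u \<le> \<phi> g p" if "g \<in> carrier G" "\<And>t. t \<in> {0<..<1} \<Longrightarrow> s \<le> t \<Longrightarrow> \<phi> g t = t" for g
    using that by force
  obtain k where k: "k \<in> carrier G" "\<phi> k b \<in> {p<..<s}" using minimal[OF b, of p s] p s by auto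
  have kb: "\<phi> k b \<in> {0<..<1}" using act_closed k b by blast
  define F where "F = k \<otimes> f \<otimes> inv k"
  have F: "F \<in> carrier G" using k f by (simp add: F_def)
  have Fk: "\<phi> F t = \<phi> k (\<phi> f (\<phi> (inv k) t))" if t: "t \<in> {0<..<1}" for t
    using act_closed[OF _ t, of "inv k"] k f t by (simp add: F_def act_mult)
  have Fup: "t < \<phi> F t" if t: "t \<in> {0<..<1}" "t < \<phi> k b" for t
  proof -
    have kt: "\<phi> (inv k) t \<in> {0<..<1}" using act_closed[OF _ t(1), of "inv k"] k by simp
    have "\<phi> (inv k) t < b" using act_inv_less_iff[OF k(1) t(1) b] t by simp
    then have "\<phi> k (\<phi> (inv k) t) < \<phi> k (\<phi> f (\<phi> (inv k) t))"
      using act_mono[OF k(1) kt act_closed[OF f kt] up[OF kt]] by simp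
    then show ?thesis using Fk[OF t(1)] act_inv2[OF k(1) t(1)] by simp
  qed
  have Ffix: "\<phi> (inv F) t = t" if t: "t \<in> {0<..<1}" "s \<le> t" for t
  proof -
    have kt: "\<phi> (inv k) t \<in> {0<..<1}" using act_closed[OF _ t(1), of "inv k"] k by simp
    have "b < \<phi> (inv k) t" using less_act_inv_iff[OF k(1) t(1) b] t k(2) by simp
    then have "\<phi> F t = t" using Fk[OF t(1)] fixed[OF kt] act_inv2[OF k(1) t(1)] by simp
    then show ?thesis using act_inv[OF F t(1)] by metis
  qed
  define P where "P = {\<phi> g p | g. g \<in> carrier G \<and> (\<forall>t\<in>{0<..<1}. s \<le> t \<longrightarrow> \<phi> g t = t)}"
  have lower: "u \<le> z" if "z \<in> P" for z using that far by (auto simp: P_def)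
  have pP: "p \<in> P" unfolding P_def using act_one p by (auto intro!: exI[of _ \<one>])
  have bdd: "bdd_below P" using lower by (rule bdd_belowI)
  define L where "L = Inf P"
  have "u \<le> L" unfolding L_def using pP lower by (intro cInf_greatest) auto
  moreover have "L \<le> p" unfolding L_def by (rule cInf_lower[OF pP bdd])
  \<comment> \<open>The bound \<open>u\<close>, supplied by the negated claim, keeps
    \<open>L\<close> away from 0, and \<open>L \<le> p < \<phi> k b\<close> keeps it where
    \<open>F\<close> pushes strictly up.\<close>
  ultimately have L: "L \<in> {0<..<1}" "L < \<phi> k b" using u p k by auto
  obtain z where z: "z \<in> P" "z < \<phi> F L"
    using cInf_lessD[of P "\<phi> F L"] Fup[OF L] pP by (auto simp: L_def)
  obtain g where g: "g \<in> carrier G" "z = \<phi> g p" "\<forall>t\<in>{0<..<1}. s \<le> t \<longrightarrow> \<phi> g t = t"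
    using z by (auto simp: P_def)
  have zI: "z \<in> {0<..<1}" using g act_closed p by blast
  have "\<phi> (inv F) z = \<phi> (inv F \<otimes> g) p" using F g p by (simp add: act_mult)
  moreover have "\<phi> (inv F \<otimes> g) t = t" if "t \<in> {0<..<1}" "s \<le> t" for t
    using that F g Ffix by (simp add: act_mult)
  ultimately have "\<phi> (inv F) z \<in> P" using F g unfolding P_def by (auto intro!: exI[of _ "inv F \<otimes> g"])
  then have "L \<le> \<phi> (inv F) z" unfolding L_def by (rule cInf_lower[OF _ bdd])
  moreover have "\<phi> (inv F) z < L" using act_inv_less_iff[OF F zI L(1)] z by simp
  ultimately show False by simp
qed

text \<open>Reflection turns a map pushing up into one pushing down, so \<open>contract_to_0\<close>
  is applied to the reflection of \<open>inv f\<close>.\<close>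

lemma contract_to_1:
  assumes f: "f \<in> carrier G" and a: "a \<in> {0<..<1}"
    and up: "\<And>t. t \<in> {0<..<1} \<Longrightarrow> a < t \<Longrightarrow> t < \<phi> f t"
    and fixed: "\<And>t. t \<in> {0<..<1} \<Longrightarrow> t \<le> a \<Longrightarrow> \<phi> f t = t"
    and q: "q \<in> {0<..<1}" and s: "s < q" "0 \<le> s" and v: "v \<in> {0<..<1}"
  shows "\<exists>g\<in>carrier G. (\<forall>t\<in>{0<..<1}. t \<le> s \<longrightarrow> \<phi> g t = t) \<and> v < \<phi> g q"
proof -
  interpret R: minimal_interval_action G "\<lambda>g x. 1 - \<phi> g (1 - x)"
    by (rule minimal_interval_action_reflect)
  have "\<exists>g\<in>carrier G. (\<forall>t\<in>{0<..<1}. 1 - s \<le> t \<longrightarrow> 1 - \<phi> g (1 - t) = t) \<and>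
      1 - \<phi> g (1 - (1 - q)) < 1 - v"
  proof (rule R.contract_to_0)
    show "inv f \<in> carrier G" "1 - a \<in> {0<..<1}" "1 - q \<in> {0<..<1}" "1 - q < 1 - s" "1 - s \<le> 1"
      "1 - v \<in> {0<..<1}"
      using f a q s v by auto
    fix t :: real assume t: "t \<in> {0<..<1}"
    then have t': "1 - t \<in> {0<..<1}" by auto
    show "t < 1 - \<phi> (inv f) (1 - t)" if "t < 1 - a"
      using act_inv_less_iff[OF f t' t'] up[OF t'] that by simp
    show "1 - \<phi> (inv f) (1 - t) = t" if "1 - a \<le> t"
      using act_inv[OF f t'] fixed[OF t'] that by simp
  qed
  then obtain g where g: "g \<in> carrier G" "v < \<phi> g q"
    "\<And>t. t \<in> {0<..<1} \<Longrightarrow> 1 - s \<le> t \<Longrightarrow> 1 - \<phi> g (1 - t) = t"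
    by auto
  have "\<phi> g t = t" if "t \<in> {0<..<1}" "t \<le> s" for t
    using g(3)[of "1 - t"] that by simp
  then show ?thesis using g by blast
qed

end

section \<open>Chain-like actions are locally moving\<close>

locale chain_like_action = minimal_interval_action +
  assumes push_from_0: "\<exists>f\<in>carrier G. \<exists>b\<in>{0<..<1}.
      (\<forall>t\<in>{0<..<1}. t < b \<longrightarrow> t < \<phi> f t) \<and> (\<forall>t\<in>{0<..<1}. b \<le> t \<longrightarrow> \<phi> f t = t)"
    and push_to_1: "\<exists>f\<in>carrier G. \<exists>a\<in>{0<..<1}.
      (\<forall>t\<in>{0<..<1}. a < t \<longrightarrow> t < \<phi> f t) \<and> (\<forall>t\<in>{0<..<1}. t \<le> a \<longrightarrow> \<phi> f t = t)"
    and germs_at_0_commute: "a \<in> carrier G \<Longrightarrow> b \<in> carrier G \<Longrightarrow> commutes_near_0 a b"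
    and germs_at_1_commute: "a \<in> carrier G \<Longrightarrow> b \<in> carrier G \<Longrightarrow> commutes_near_1 a b"
begin

lemma commutator_compactly_moved:
  assumes "a \<in> carrier G" "b \<in> carrier G"
  shows "\<exists>u v. 0 < u \<and> v < 1 \<and> moved (commutator G a b) \<subseteq> {u..v}"
proof -
  obtain u where u: "u \<in> {0<..<1}" "\<And>t. t \<in> {0<..<1} \<Longrightarrow> t < u \<Longrightarrow> \<phi> (commutator G a b) t = t"
    using commutator_trivial_near_0[OF assms germs_at_0_commute[OF assms]] by blast
  obtain v where v: "v \<in> {0<..<1}" "\<And>t. t \<in> {0<..<1} \<Longrightarrow> v < t \<Longrightarrow> \<phi> (commutator G a b) t = t"
    using commutator_trivial_near_1[OF assms germs_at_1_commute[OF assms]] by blast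
  have "moved (commutator G a b) \<subseteq> {u..v}" using u v by (force simp: moved_def)
  then show ?thesis using u v by auto
qed

text \<open>Whatever commutes with \<open>f\<close> preserves its fixed points. The end
  \<open>b\<close> of the support of \<open>f\<close> is fixed, but minimality yields
  \<open>k\<close> carrying it below \<open>b\<close>, where \<open>f\<close> moves every
  point.\<close>

lemma noncommuting:
  obtains a b where "a \<in> carrier G" "b \<in> carrier G" "\<not> commutes G a b"
proof -
  obtain f b where f: "f \<in> carrier G" and b: "b \<in> {0<..<1}"
    and up: "\<And>t. t \<in> {0<..<1} \<Longrightarrow> t < b \<Longrightarrow> t < \<phi> f t"
    and fixed: "\<And>t. t \<in> {0<..<1} \<Longrightarrow> b \<le> t \<Longrightarrow> \<phi> f t = t"
    using push_from_0 by blast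
  obtain k where k: "k \<in> carrier G" "\<phi> k b \<in> {0<..<b}" using minimal[OF b, of 0 b] b by auto
  have "\<phi> k b < \<phi> f (\<phi> k b)" using up[OF act_closed[OF k(1) b]] k by simp
  then have "\<phi> f (\<phi> k b) \<noteq> \<phi> k (\<phi> f b)" using fixed[OF b] by simp
  then have "\<not> commutes G f k" using commutes_iff[OF f k(1)] b by blast
  then show thesis using that f k by blast
qed

text \<open>One nontrivial commutator moves a whole interval; minimality carries \<open>x\<close>
  into it, and conjugating back gives a commutator again.\<close>

lemma commutator_moves:
  assumes x: "x \<in> {0<..<1}"
  shows "\<exists>a\<in>carrier G. \<exists>b\<in>carrier G. x \<in> moved (commutator G a b)"
proof -
  obtain a b where ab: "a \<in> carrier G" "b \<in> carrier G" "\<not> commutes G a b" by (rule noncommuting)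
  define e where "e = commutator G a b"
  have e: "e \<in> carrier G" "e \<noteq> \<one>" using ab commutes_if_commutator_eq_one by (auto simp: e_def)
  obtain y where y: "y \<in> moved e" using moved_nonempty[OF e] by blast
  obtain p q where pq: "p \<in> {0<..<1}" "q \<in> {0<..<1}" "p < y" "y < q" "{p<..<q} \<subseteq> moved e"
    using displaced_nbhd[OF e(1) y] by metis
  obtain k where k: "k \<in> carrier G" "\<phi> k x \<in> {p<..<q}" using minimal[OF x, of p q] pq by auto
  have "x \<in> moved (inv k \<otimes> e \<otimes> inv (inv k))"
    using moved_conj_iff[OF e(1) inv_closed[OF k(1)] x] k pq by auto
  moreover have "inv k \<otimes> e \<otimes> inv (inv k) =
      commutator G (inv k \<otimes> a \<otimes> inv (inv k)) (inv k \<otimes> b \<otimes> inv (inv k))"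
    unfolding e_def by (rule conj_commutator) (use ab k in auto)
  ultimately show ?thesis using ab k by (metis inv_closed m_closed)
qed

text \<open>
  Zooming: some \<open>g\<close> fixes \<open>x\<close> and stretches the given neighbourhood over the compact support of an
  element moving \<open>x\<close>.
\<close>

sublocale locally_moving_action
proof
  fix p x q :: real assume px: "p < x" and xq: "x < q" and x: "x \<in> {0<..<1}"
  obtain a b where ab: "a \<in> carrier G" "b \<in> carrier G" and xe: "x \<in> moved (commutator G a b)"
    using commutator_moves[OF x] by blast
  define e where "e = commutator G a b"
  have e: "e \<in> carrier G" using ab by (simp add: e_def)
  obtain u v where uv: "0 < u" "v < 1" "moved e \<subseteq> {u..v}"
    using commutator_compactly_moved[OF ab] unfolding e_def by blast
  then have uv': "u \<in> {0<..<1}" "v \<in> {0<..<1}"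
    using xe x by (auto simp: e_def)
  \<comment> \<open>The given window may exceed the unit interval; halving the distance from
    \<open>x\<close> to the ends clips it to a window with endpoints inside.\<close>
  define p' where "p' = max p (x / 2)"
  define q' where "q' = min q ((x + 1) / 2)"
  have pq: "p' \<in> {0<..<1}" "q' \<in> {0<..<1}" "p' < x" "x < q'" "{p'<..<q'} \<subseteq> {p<..<q}"
    using px xq x by (auto simp: p'_def q'_def max_def min_def)
  obtain s where s: "p' < s" "s < x" using dense pq by blast
  obtain g where g: "g \<in> carrier G" "\<forall>t\<in>{0<..<1}. s \<le> t \<longrightarrow> \<phi> g t = t" "\<phi> g p' < u"
  proof -
    obtain f b where "f \<in> carrier G" "b \<in> {0<..<1}"
      "\<And>t. t \<in> {0<..<1} \<Longrightarrow> t < b \<Longrightarrow> t < \<phi> f t"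
      "\<And>t. t \<in> {0<..<1} \<Longrightarrow> b \<le> t \<Longrightarrow> \<phi> f t = t"
      using push_from_0 by blast
    moreover have "s \<le> 1" using s x by simp
    ultimately have "\<exists>g\<in>carrier G. (\<forall>t\<in>{0<..<1}. s \<le> t \<longrightarrow> \<phi> g t = t) \<and> \<phi> g p' < u"
      by (intro contract_to_0[OF _ _ _ _ pq(1) s(1) _ uv'(1)])
    then show thesis using that by blast
  qed
  obtain r where r: "x < r" "r < q'" using dense pq by blast
  obtain h where h: "h \<in> carrier G" "\<forall>t\<in>{0<..<1}. t \<le> r \<longrightarrow> \<phi> h t = t" "v < \<phi> h q'"
  proof -
    obtain f a where "f \<in> carrier G" "a \<in> {0<..<1}"
      "\<And>t. t \<in> {0<..<1} \<Longrightarrow> a < t \<Longrightarrow> t < \<phi> f t"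
      "\<And>t. t \<in> {0<..<1} \<Longrightarrow> t \<le> a \<Longrightarrow> \<phi> f t = t"
      using push_to_1 by blast
    moreover have "0 \<le> r" using r x by simp
    ultimately have "\<exists>g\<in>carrier G. (\<forall>t\<in>{0<..<1}. t \<le> r \<longrightarrow> \<phi> g t = t) \<and> v < \<phi> g q'"
      by (intro contract_to_1[OF _ _ _ _ pq(2) r(2) _ uv'(2)])
    then show thesis using that by blast
  qed
  \<comment> \<open>The buffers \<open>s < x < r\<close> make the two stretches independent:
    \<open>g\<close> fixes \<open>x\<close> and \<open>q'\<close>, while \<open>h\<close> fixes
    \<open>x\<close> and also \<open>\<phi> g p'\<close>, which lies below \<open>s\<close>. So
    \<open>k\<close> fixes \<open>x\<close> and moves \<open>p'\<close> below \<open>u\<close> and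
    \<open>q'\<close> above \<open>v\<close>.\<close>
  define k where "k = h \<otimes> g"
  have k: "k \<in> carrier G" using g h by (simp add: k_def)
  have gp: "\<phi> g p' \<in> {0<..<1}" using act_closed g pq by blast
  have "\<phi> g p' < \<phi> g s" by (rule act_mono) (use g pq s x in auto)
  then have "\<phi> g p' \<le> r" using g(2) s x pq r by auto
  then have kp: "\<phi> k p' < u" using h g pq gp by (simp add: k_def act_mult)
  have kq: "v < \<phi> k q'" using h g pq s by (simp add: k_def act_mult)
  have kx: "\<phi> k x = x" using h g pq s r x by (simp add: k_def act_mult)
  define m where "m = inv k \<otimes> e \<otimes> inv (inv k)"
  have m: "m \<in> carrier G" using k e by (simp add: m_def)
  have mk: "z \<in> moved m \<longleftrightarrow> \<phi> k z \<in> moved e" if "z \<in> {0<..<1}" for z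
    using moved_conj_iff[OF e inv_closed[OF k] that] k by (simp add: m_def)
  have "x \<in> moved m" using mk[OF x] kx xe by (simp add: e_def)
  moreover have "moved m \<subseteq> {p<..<q}"
  proof
    fix z assume z: "z \<in> moved m"
    then have zI: "z \<in> {0<..<1}" using moved_subset by blast
    then have "\<phi> k p' < \<phi> k z" "\<phi> k z < \<phi> k q'" using mk z uv kp kq by force+
    then have "z \<in> {p'<..<q'}" using act_less_iff[OF k] zI pq by auto
    then show "z \<in> {p<..<q}" using pq by blast
  qed
  ultimately show "\<exists>k\<in>carrier G. x \<in> moved k \<and> moved k \<subseteq> {p<..<q}" using m by blast
qed

end

section \<open>Reconstruction of the conjugating homeomorphism\<close>

context locally_moving_action
begin

lemma separate_from_closure:
  assumes y: "y \<in> {0<..<1}" "y \<notin> closure T"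
  obtains m where "m \<in> carrier G" "y \<in> moved m" "moved m \<inter> T = {}"
proof -
  have "open (- closure T)" "y \<in> - closure T" using y by auto
  then obtain e where e: "e > 0" "ball y e \<subseteq> - closure T" using openE by blast
  then have "{y - e<..<y + e} \<subseteq> - closure T" by (simp add: ball_eq_greaterThanLessThan)
  moreover obtain m where "m \<in> carrier G" "y \<in> moved m" "moved m \<subseteq> {y - e<..<y + e}"
    using locally_moving[of "y - e" y "y + e"] y e by auto
  ultimately show thesis using that closure_subset[of T] by blast
qed

end

text \<open>Besides the common group, \<open>compactly_moved\<close> is the only link between the
  actions; it confines all partners of \<open>x\<close> to a compact \<open>{u..v}\<close>.\<close>

locale locally_moving_pair = A: locally_moving_action G \<alpha> + B: locally_moving_action G \<beta>
  for G (structure) and \<alpha> \<beta> +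
  assumes compactly_moved:
    "x \<in> {0<..<1} \<Longrightarrow> \<exists>g\<in>carrier G. x \<in> A.moved g \<and> (\<exists>u v. 0 < u \<and> v < 1 \<and> B.moved g \<subseteq> {u..v})"
begin

text \<open>Phrasing it by \<open>algebraically_disjoint\<close> rather than by the supports of one
  action makes the relation symmetric in the two actions.\<close>

definition related :: "real \<Rightarrow> real \<Rightarrow> bool" where
  "related x y \<longleftrightarrow> x \<in> {0<..<1} \<and> y \<in> {0<..<1} \<and>
    (\<forall>g\<in>carrier G. \<forall>m\<in>carrier G. x \<in> A.moved g \<longrightarrow> y \<in> B.moved m \<longrightarrow>
      \<not> algebraically_disjoint G g m)"

lemma disjoint_iff_disjoint:
  "f \<in> carrier G \<Longrightarrow> g \<in> carrier G \<Longrightarrow> A.moved f \<inter> A.moved g = {} \<longleftrightarrow> B.moved f \<inter> B.moved g = {}"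
  using A.algebraically_disjoint_iff B.algebraically_disjoint_iff by blast

text \<open>An open set misses a set exactly if it misses its closure, and outside a closure there
  is room for an element moving \<open>y\<close>. The partners of \<open>x\<close> thus form an
  intersection of closed sets.\<close>

lemma related_iff_closure:
  assumes "x \<in> {0<..<1}" "y \<in> {0<..<1}"
  shows "related x y \<longleftrightarrow> (\<forall>g\<in>carrier G. x \<in> A.moved g \<longrightarrow> y \<in> closure (B.moved g))"
proof
  assume R: "related x y"
  show "\<forall>g\<in>carrier G. x \<in> A.moved g \<longrightarrow> y \<in> closure (B.moved g)"
  proof (intro ballI impI, rule ccontr)
    fix g assume g: "g \<in> carrier G" "x \<in> A.moved g" "y \<notin> closure (B.moved g)"
    obtain m where "m \<in> carrier G" "y \<in> B.moved m" "B.moved m \<inter> B.moved g = {}"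
      using B.separate_from_closure[OF assms(2) g(3)] by blast
    then show False
      using R g B.algebraically_disjoint_iff[of g m] unfolding related_def by blast
  qed
next
  assume C: "\<forall>g\<in>carrier G. x \<in> A.moved g \<longrightarrow> y \<in> closure (B.moved g)"
  have "\<not> algebraically_disjoint G g m"
    if "g \<in> carrier G" "m \<in> carrier G" "x \<in> A.moved g" "y \<in> B.moved m" for g m
    using C that open_Int_closure_eq_empty[OF B.open_moved[OF that(2)], of "B.moved g"]
      B.algebraically_disjoint_iff[OF that(1,2)] by blast
  then show "related x y" using assms unfolding related_def by blast
qed

text \<open>Finite intersection property: finitely many elements moving \<open>x\<close> in the
  first action have supports with a common neighbourhood of \<open>x\<close>. An element
  \<open>k\<close> supported there has its second support in each of the closures.\<close>

lemma related_exists: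
  assumes x: "x \<in> {0<..<1}"
  shows "\<exists>y. related x y"
proof -
  obtain g0 u v where g0: "g0 \<in> carrier G" "x \<in> A.moved g0" and uv: "0 < u" "v < 1" "B.moved g0 \<subseteq> {u..v}"
    using compactly_moved[OF x] by blast
  define N where "N = {g \<in> carrier G. x \<in> A.moved g}"
  have "{u..v} \<inter> \<Inter> ((\<lambda>g. closure (B.moved g)) ` N) \<noteq> {}"
  proof (rule compact_imp_fip)
    fix F assume F: "finite F" "F \<subseteq> (\<lambda>g. closure (B.moved g)) ` N"
    then obtain M where M: "M \<subseteq> N" "finite M" "F = (\<lambda>g. closure (B.moved g)) ` M"
      by (meson finite_subset_image)
    \<comment> \<open>Including \<open>g0\<close> forces the common point into
      \<open>{u..v}\<close>, even if the finite family is empty.\<close>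
    define M' where "M' = insert g0 M"
    have M': "M' \<subseteq> N" "finite M'" using M g0 by (auto simp: M'_def N_def)
    have "open (\<Inter>g\<in>M'. A.moved g)"
      using M' A.open_moved by (intro open_INT) (auto simp: N_def)
    moreover have "x \<in> (\<Inter>g\<in>M'. A.moved g)" using M' by (auto simp: N_def)
    ultimately obtain e where e: "e > 0" "ball x e \<subseteq> (\<Inter>g\<in>M'. A.moved g)" by (rule openE)
    obtain k where k: "k \<in> carrier G" "x \<in> A.moved k" "A.moved k \<subseteq> {x - e<..<x + e}"
      using A.locally_moving[of "x - e" x "x + e"] x e by auto
    have kM: "A.moved k \<subseteq> A.moved g" if "g \<in> M'" for g
      using k e that by (auto simp: ball_eq_greaterThanLessThan)
    have "k \<noteq> \<one>" using k A.act_one x by (auto simp: A.moved_def)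
    then obtain z where z: "z \<in> B.moved k" using B.moved_nonempty[OF k(1)] by blast
    have zI: "z \<in> {0<..<1}" using z B.moved_subset by blast
    \<comment> \<open>Inclusion of supports in the first action gives inclusion up to closure in the
      second: what is disjoint from \<open>g\<close> is disjoint from \<open>k\<close>, and
      disjointness is the same in both actions.\<close>
    have zc: "z \<in> closure (B.moved g)" if g: "g \<in> M'" for g
    proof (rule ccontr)
      assume "z \<notin> closure (B.moved g)"
      then obtain m where m: "m \<in> carrier G" "z \<in> B.moved m" "B.moved m \<inter> B.moved g = {}"
        using B.separate_from_closure[OF zI] by blast
      have "g \<in> carrier G" using g M' by (auto simp: N_def)
      then have "A.moved m \<inter> A.moved k = {}"
        using disjoint_iff_disjoint[OF m(1)] m(3) kM[OF g] by blast
      then show False using disjoint_iff_disjoint[OF m(1) k(1)] m(2) z by blast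
    qed
    moreover have "z \<in> {u..v}"
      using zc[of g0] closure_minimal[OF uv(3) closed_atLeastAtMost] by (auto simp: M'_def)
    ultimately have "z \<in> {u..v} \<inter> \<Inter>F" unfolding M(3) by (auto simp: M'_def)
    then show "{u..v} \<inter> \<Inter>F \<noteq> {}" by blast
  qed auto
  then obtain y where y: "y \<in> {u..v}" "\<forall>g\<in>N. y \<in> closure (B.moved g)" by blast
  have "y \<in> {0<..<1}" using y(1) uv by auto
  then have "related x y" using related_iff_closure[OF x] y(2) by (auto simp: N_def)
  then show ?thesis ..
qed

lemma related_act:
  assumes k: "k \<in> carrier G" and R: "related x y"
  shows "related (\<alpha> k x) (\<beta> k y)"
proof -
  have x: "x \<in> {0<..<1}" and y: "y \<in> {0<..<1}" using R by (auto simp: related_def)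
  have kx: "\<alpha> k x \<in> {0<..<1}" and ky: "\<beta> k y \<in> {0<..<1}"
    using x y k A.act_closed B.act_closed by blast+
  have "\<not> algebraically_disjoint G g m"
    if gm: "g \<in> carrier G" "m \<in> carrier G" "\<alpha> k x \<in> A.moved g" "\<beta> k y \<in> B.moved m" for g m
  proof
    assume "algebraically_disjoint G g m"
    then have disj: "B.moved g \<inter> B.moved m = {}"
      using B.algebraically_disjoint_iff gm by blast
    define g' where "g' = inv k \<otimes> g \<otimes> inv (inv k)"
    define m' where "m' = inv k \<otimes> m \<otimes> inv (inv k)"
    have C: "g' \<in> carrier G" "m' \<in> carrier G" using gm k by (auto simp: g'_def m'_def)
    have "x \<in> A.moved g'" "y \<in> B.moved m'"
      using gm k x y A.moved_conj_iff[of g "inv k" x] B.moved_conj_iff[of m "inv k" y]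
      by (auto simp: g'_def m'_def)
    moreover have "B.moved g' \<inter> B.moved m' = {}"
    proof -
      have "z \<notin> B.moved g' \<or> z \<notin> B.moved m'" if "z \<in> {0<..<1}" for z
        using that gm k disj B.moved_conj_iff[of g "inv k" z] B.moved_conj_iff[of m "inv k" z]
        by (auto simp: g'_def m'_def)
      then show ?thesis using B.moved_subset by blast
    qed
    ultimately show False
      using R C B.algebraically_disjoint_iff[OF C] unfolding related_def by blast
  qed
  then show ?thesis using kx ky unfolding related_def by blast
qed

lemma related_fixed:
  assumes R: "related x y" and k: "k \<in> carrier G" and y: "y \<notin> closure (B.moved k)"
  shows "\<alpha> k x = x"
proof (rule ccontr)
  assume "\<alpha> k x \<noteq> x"
  moreover have xy: "x \<in> {0<..<1}" "y \<in> {0<..<1}" using R by (auto simp: related_def)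
  ultimately show False using related_iff_closure[OF xy] R k y by (auto simp: A.moved_def)
qed

text \<open>
  Were there two points related to \<open>x\<close>, an element supported near the topmost one and away from the
  other would fix \<open>x\<close> and push the topmost one further up.
\<close>

lemma related_unique:
  assumes "related x y" "related x y'"
  shows "y = y'"
proof -
  have x: "x \<in> {0<..<1}" using assms by (auto simp: related_def)
  obtain g u v where g: "g \<in> carrier G" "x \<in> A.moved g" and uv: "0 < u" "v < 1" "B.moved g \<subseteq> {u..v}"
    using compactly_moved[OF x] by blast
  define Y where "Y = {y. related x y}"
  have YI: "Y \<subseteq> {0<..<1}" by (auto simp: Y_def related_def)
  have Yuv: "Y \<subseteq> {u..v}"
  proof
    fix z assume z: "z \<in> Y"
    then have "z \<in> closure (B.moved g)"
      using related_iff_closure[OF x] g YI by (auto simp: Y_def)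
    moreover have "closure (B.moved g) \<subseteq> {u..v}" using uv(3) by (simp add: closure_minimal)
    ultimately show "z \<in> {u..v}" by blast
  qed
  have Yne: "Y \<noteq> {}" using assms by (auto simp: Y_def)
  have bdd: "bdd_above Y" using Yuv by (meson bdd_above_Icc bdd_above_mono)
  define t where "t = Sup Y"
  have upper: "z \<le> t" if "z \<in> Y" for z using cSup_upper[OF that bdd] by (simp add: t_def)
  have "t \<le> v" unfolding t_def using Yuv by (intro cSup_least[OF Yne]) auto
  moreover have "u \<le> t" using Yuv Yne upper by (meson atLeastAtMost_iff ex_in_conv order_trans subsetD)
  ultimately have t: "t \<in> {0<..<1}" using uv by auto
  have tcl: "t \<in> closure Y" unfolding t_def by (rule closure_contains_Sup[OF Yne bdd])
  \<comment> \<open>The topmost candidate is itself related to \<open>x\<close>, since each closure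
    condition passes to limits of points of \<open>Y\<close>.\<close>
  have Rt: "related x t"
    unfolding related_iff_closure[OF x t]
  proof (intro ballI impI)
    fix k assume k: "k \<in> carrier G" "x \<in> A.moved k"
    then have "Y \<subseteq> closure (B.moved k)"
      using related_iff_closure[OF x] YI by (auto simp: Y_def)
    then show "t \<in> closure (B.moved k)" using tcl closure_minimal closed_closure by blast
  qed
  have top: "z = t" if z: "z \<in> Y" for z
  proof (rule ccontr)
    assume "z \<noteq> t"
    then have zt: "z < t" using upper[OF z] by simp
    then obtain r where r: "z < r" "r < t" using dense by blast
    obtain k where k: "k \<in> carrier G" "t \<in> B.moved k" "B.moved k \<subseteq> {r<..<1}"
      using B.locally_moving[of r t 1] r t by auto
    have "closure (B.moved k) \<subseteq> {r..1}" using k(3) by (intro closure_minimal) auto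
    then have zk: "z \<notin> closure (B.moved k)" using r by auto
    \<comment> \<open>Stated for \<open>k'\<close> to cover both \<open>k\<close> and its inverse:
      they have the same support, and one of them raises \<open>t\<close>.\<close>
    have no_rise: False if k': "k' \<in> carrier G" "B.moved k' = B.moved k" "t < \<beta> k' t" for k'
    proof -
      have "\<alpha> k' x = x" using related_fixed[of x z k'] z zk k' by (auto simp: Y_def)
      then have "\<beta> k' t \<in> Y" using related_act[OF k'(1) Rt] by (simp add: Y_def)
      then show False using upper k'(3) by force
    qed
    show False
    proof (cases "t < \<beta> k t")
      case True
      then show False using no_rise[of k] k by simp
    next
      case False
      then have "\<beta> k t < t" using k(2) by (auto simp: B.moved_def)
      then have "t < \<beta> (inv k) t" using B.less_act_inv_iff[OF k(1) t t] by simp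
      then show False using no_rise[of "inv k"] k by simp
    qed
  qed
  show ?thesis using top[of y] top[of y'] assms by (simp add: Y_def)
qed

definition conjugator :: "real \<Rightarrow> real" where
  "conjugator x = (THE y. related x y)"

lemma related_iff_conjugator:
  assumes "x \<in> {0<..<1}"
  shows "related x y \<longleftrightarrow> y = conjugator x"
proof -
  obtain z where z: "related x z" using related_exists[OF assms] by blast
  then have "conjugator x = z"
    unfolding conjugator_def using related_unique by blast
  then show ?thesis using z related_unique by blast
qed

lemma related_conjugator: "x \<in> {0<..<1} \<Longrightarrow> related x (conjugator x)"
  using related_iff_conjugator by blast

lemma conjugator_closed: "x \<in> {0<..<1} \<Longrightarrow> conjugator x \<in> {0<..<1}"
  using related_conjugator by (auto simp: related_def)

lemma conjugator_act:
  "k \<in> carrier G \<Longrightarrow> x \<in> {0<..<1} \<Longrightarrow> conjugator (\<alpha> k x) = \<beta> k (conjugator x)"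
  using related_act[OF _ related_conjugator] related_iff_conjugator[OF A.act_closed] by metis

text \<open>Closed graph theorem, applied on a neighbourhood \<open>A.moved g\<close> of each point,
  where the values stay in a compact \<open>{u..v}\<close>. The pairs that are not related form the
  open set \<open>W\<close>, a union of products of supports of algebraically disjoint
  elements.\<close>

lemma continuous_on_conjugator: "continuous_on {0<..<1} conjugator"
proof -
  have "\<exists>N. open N \<and> x \<in> N \<and> continuous_on N conjugator" if x: "x \<in> {0<..<1}" for x
  proof -
    obtain g u v where g: "g \<in> carrier G" "x \<in> A.moved g"
      and uv: "0 < u" "v < 1" "B.moved g \<subseteq> {u..v}"
      using compactly_moved[OF x] by blast
    let ?N = "A.moved g"
    have NI: "?N \<subseteq> {0<..<1}" by (rule A.moved_subset)
    have "closure (B.moved g) \<subseteq> {u..v}" using uv(3) by (simp add: closure_minimal)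
    then have maps: "conjugator z \<in> {u..v}" if "z \<in> ?N" for z
      using that related_iff_closure[of z "conjugator z"] related_conjugator conjugator_closed NI g(1)
      by blast
    define W where "W = (\<Union>k\<in>carrier G. \<Union>m\<in>{m \<in> carrier G. algebraically_disjoint G k m}.
      A.moved k \<times> B.moved m)"
    have "open W" unfolding W_def
      using A.open_moved B.open_moved by (intro open_UN ballI open_Times) auto
    have "(\<lambda>x. (x, conjugator x)) ` ?N = (?N \<times> {u..v}) \<inter> - W"
    proof -
      have "(z, w) \<in> (\<lambda>x. (x, conjugator x)) ` ?N \<longleftrightarrow> (z, w) \<notin> W"
        if zw: "z \<in> ?N" "w \<in> {u..v}" for z w
      proof -
        have I: "z \<in> {0<..<1}" "w \<in> {0<..<1}" using zw NI uv by auto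
        then have "related z w \<longleftrightarrow> (z, w) \<notin> W" unfolding related_def W_def by blast
        then show ?thesis using zw related_iff_conjugator[OF I(1)] by auto
      qed
      then show ?thesis using maps by auto
    qed
    moreover have "closedin (top_of_set (?N \<times> {u..v})) ((?N \<times> {u..v}) \<inter> - W)"
      using \<open>open W\<close> by (intro closedin_closed_Int) (simp add: closed_Compl)
    ultimately have "continuous_on ?N conjugator"
      using continuous_closed_graph_eq[of "{u..v}" conjugator ?N] maps by auto
    then show ?thesis using A.open_moved g by blast
  qed
  then show ?thesis
    by (metis continuous_at_imp_continuous_on continuous_on_eq_continuous_at)
qed

end

locale bilocally_moving_pair = AB: locally_moving_pair G \<alpha> \<beta> + BA: locally_moving_pair G \<beta> \<alpha>
  for G (structure) and \<alpha> \<beta>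
begin

text \<open>The formula for algebraic disjointness is not visibly symmetric in its two elements;
  symmetry comes from its meaning as disjointness of supports.\<close>

lemma related_sym: "AB.related x y \<longleftrightarrow> BA.related y x"
proof -
  have "algebraically_disjoint G g m \<longleftrightarrow> algebraically_disjoint G m g"
    if "g \<in> carrier G" "m \<in> carrier G" for g m
    using that AB.A.algebraically_disjoint_iff by blast
  then show ?thesis unfolding AB.related_def BA.related_def by blast
qed

lemma bij_betw_conjugator: "bij_betw AB.conjugator {0<..<1} {0<..<1}"
proof (rule bij_betw_byWitness[where f' = BA.conjugator])
  show "\<forall>x\<in>{0<..<1}. BA.conjugator (AB.conjugator x) = x"
    using AB.related_conjugator AB.conjugator_closed BA.related_iff_conjugator related_sym by metis
  show "\<forall>x\<in>{0<..<1}. AB.conjugator (BA.conjugator x) = x"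
    using BA.related_conjugator BA.conjugator_closed AB.related_iff_conjugator related_sym by metis
qed (use AB.conjugator_closed BA.conjugator_closed in blast)+

end

section \<open>Chain groups\<close>

lemma HomeoPlus_carrierD:
  assumes "f \<in> carrier HomeoPlus"
  shows "f \<in> Bij unit_ivl" "strict_mono_on unit_ivl f" "f 0 = 0" "f 1 = 1"
proof -
  show B: "f \<in> Bij unit_ivl" and mono: "strict_mono_on unit_ivl f"
    using assms by (auto simp: HomeoPlus_def homeo_plus_def)
  have bij: "bij_betw f unit_ivl unit_ivl" using B by (simp add: Bij_def)
  have le: "f x \<le> f y" if "x \<in> unit_ivl" "y \<in> unit_ivl" "x \<le> y" for x y
    using strict_mono_onD[OF mono that(1,2)] that(3) by (cases "x = y") auto
  have mem: "f x \<in> unit_ivl" if "x \<in> unit_ivl" for x using bij that by (rule bij_betw_apply)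
  have "0 \<in> f ` unit_ivl" "1 \<in> f ` unit_ivl" using bij_betw_imp_surj_on[OF bij] by auto
  then obtain x y where "x \<in> unit_ivl" "f x = 0" "y \<in> unit_ivl" "f y = 1" by fastforce
  then show "f 0 = 0" "f 1 = 1" using le[of 0 x] le[of y 1] mem[of 0] mem[of 1] by auto
qed

lemma HomeoPlus_closed:
  assumes f: "f \<in> carrier HomeoPlus" and x: "x \<in> {0<..<1}"
  shows "f x \<in> {0<..<1}"
  using strict_mono_onD[OF HomeoPlus_carrierD(2)[OF f], of 0 x]
    strict_mono_onD[OF HomeoPlus_carrierD(2)[OF f], of x 1] HomeoPlus_carrierD(3,4)[OF f] x by simp

lemma HomeoPlus_mult:
  assumes "f \<in> carrier HomeoPlus" "g \<in> carrier HomeoPlus" "x \<in> unit_ivl"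
  shows "(f \<otimes>\<^bsub>HomeoPlus\<^esub> g) x = f (g x)"
  using assms(3) HomeoPlus_carrierD(1)[OF assms(1)] HomeoPlus_carrierD(1)[OF assms(2)]
  by (simp add: HomeoPlus_def BijGroup_def compose_def)

lemma HomeoPlus_one: "\<one>\<^bsub>HomeoPlus\<^esub> = (\<lambda>x\<in>unit_ivl. x)"
  by (simp add: HomeoPlus_def BijGroup_def)

text \<open>The tautological action lets the lemmas on germs and fixed points be applied to the
  generating homeomorphisms themselves.\<close>

lemma interval_action_HomeoPlus: "interval_action HomeoPlus (\<lambda>f. f)"
proof -
  interpret group HomeoPlus by (rule group_HomeoPlus)
  show ?thesis
  proof
    fix f g and x y :: real
    assume f: "f \<in> carrier HomeoPlus" and x: "x \<in> {0<..<1}"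
    show "f x \<in> {0<..<1}" by (rule HomeoPlus_closed[OF f x])
    show "(f \<otimes>\<^bsub>HomeoPlus\<^esub> g) x = f (g x)" if "g \<in> carrier HomeoPlus"
      using HomeoPlus_mult[OF f that] x by simp
    show "f x < f y" if "y \<in> {0<..<1}" "x < y"
      using strict_mono_onD[OF HomeoPlus_carrierD(2)[OF f], of x y] x that by simp
  next
    fix f assume f: "f \<in> carrier HomeoPlus" and fixed: "\<And>x. x \<in> {0<..<1} \<Longrightarrow> f x = x"
    show "f = \<one>\<^bsub>HomeoPlus\<^esub>"
      unfolding HomeoPlus_one
    proof (rule extensionalityI)
      show "f \<in> extensional unit_ivl" using HomeoPlus_carrierD(1)[OF f] by (simp add: Bij_def)
      show "(\<lambda>x\<in>unit_ivl. x) \<in> extensional unit_ivl" by simp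
      fix x :: real assume "x \<in> unit_ivl"
      then show "f x = (\<lambda>x\<in>unit_ivl. x) x"
        using fixed[of x] HomeoPlus_carrierD(3,4)[OF f] by (cases "x = 0 \<or> x = 1") auto
    qed
  qed
qed

lemma interval_action_if_hom:
  assumes "group G" "\<phi> \<in> hom G HomeoPlus" "inj_on \<phi> (carrier G)"
  shows "interval_action G \<phi>"
proof -
  interpret G: group G by (rule assms(1))
  interpret H: interval_action HomeoPlus "\<lambda>f. f" by (rule interval_action_HomeoPlus)
  have mem: "\<phi> g \<in> carrier HomeoPlus" if "g \<in> carrier G" for g
    using hom_in_carrier[OF assms(2) that] .
  show ?thesis
  proof
    fix g h and x y :: real
    assume g: "g \<in> carrier G" and x: "x \<in> {0<..<1}"
    show "\<phi> g x \<in> {0<..<1}" by (rule H.act_closed[OF mem[OF g] x])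
    show "\<phi> (g \<otimes>\<^bsub>G\<^esub> h) x = \<phi> g (\<phi> h x)" if "h \<in> carrier G"
      using hom_mult[OF assms(2) g that] H.act_mult[OF mem[OF g] mem[OF that] x] by simp
    show "\<phi> g x < \<phi> g y" if "y \<in> {0<..<1}" "x < y"
      by (rule H.act_mono[OF mem[OF g] x that])
  next
    fix g assume g: "g \<in> carrier G" and "\<And>x. x \<in> {0<..<1} \<Longrightarrow> \<phi> g x = x"
    then have "\<phi> g = \<one>\<^bsub>HomeoPlus\<^esub>" using H.faithful[OF mem[OF g]] by blast
    also have "\<dots> = \<phi> \<one>\<^bsub>G\<^esub>" using hom_one[OF assms(2,1) group_HomeoPlus] by simp
    finally show "g = \<one>\<^bsub>G\<^esub>" using inj_onD[OF assms(3)] g by blast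
  qed
qed

lemma open_interval_eq:
  fixes J :: "real set"
  assumes "open J" "is_interval J" "J \<noteq> {}" "bdd_below J" "bdd_above J"
  shows "J = {Inf J<..<Sup J}"
proof
  show "{Inf J<..<Sup J} \<subseteq> J"
  proof
    fix z assume z: "z \<in> {Inf J<..<Sup J}"
    then obtain x y where "x \<in> J" "x < z" "y \<in> J" "z < y"
      using cInf_lessD[OF assms(3)] less_cSupD[OF assms(3)] by (metis greaterThanLessThan_iff)
    then show "z \<in> J" using mem_is_interval_1_I[OF assms(2), of x y z] by simp
  qed
  show "J \<subseteq> {Inf J<..<Sup J}"
  proof
    fix z assume z: "z \<in> J"
    obtain e where e: "e > 0" "ball z e \<subseteq> J" using openE[OF assms(1) z] by blast
    have "z - e / 2 \<in> J" "z + e / 2 \<in> J" using e by (auto simp: subset_iff dist_real_def)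
    then have "Inf J \<le> z - e / 2" "z + e / 2 \<le> Sup J"
      using cInf_lower[OF _ assms(4)] cSup_upper[OF _ assms(5)] by blast+
    then show "z \<in> {Inf J<..<Sup J}" using e(1) by simp
  qed
qed

text \<open>Left endpoints increase by assumption. If a right endpoint did not, the next interval
  would lie inside the current one, against properness of their intersection.\<close>

lemma chain_of_intervals_endpoints:
  assumes chain: "chain_of_intervals n J" and left: "\<forall>i. 1 \<le> i \<and> i < n \<longrightarrow> Inf (J i) < Inf (J (i + 1))"
  obtains a b where "\<And>i. i \<in> {1..n} \<Longrightarrow> J i = {a i<..<b i} \<and> a i < b i \<and> 0 \<le> a i \<and> b i \<le> 1"
    "\<And>i. i \<in> {2..n} \<Longrightarrow> a 1 < a i" "\<And>i. i \<in> {1..<n} \<Longrightarrow> b i < b n"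
proof -
  define a where "a = (\<lambda>i. Inf (J i))"
  define b where "b = (\<lambda>i. Sup (J i))"
  have J: "J i = {a i<..<b i} \<and> a i < b i \<and> 0 \<le> a i \<and> b i \<le> 1" if "i \<in> {1..n}" for i
  proof -
    have *: "J i \<noteq> {}" "open (J i)" "is_interval (J i)" "J i \<subseteq> {0<..<1}"
      using chain that by (auto simp: chain_of_intervals_def)
    have "bdd_below (J i)" "bdd_above (J i)"
      using *(4) by (meson bdd_below_Ioo bdd_below_mono bdd_above_Ioo bdd_above_mono)+
    then have eq: "J i = {a i<..<b i}" unfolding a_def b_def by (rule open_interval_eq[OF *(2,3,1)])
    have "a i < b i" using eq *(1) by force
    moreover have "0 \<le> a i" unfolding a_def using *(1,4) by (intro cInf_greatest) auto
    moreover have "b i \<le> 1" unfolding b_def using *(1,4) by (intro cSup_least) auto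
    ultimately show ?thesis using eq by blast
  qed
  have step_a: "a i < a (Suc i)" if "1 \<le> i" "i < n" for i using left that by (auto simp: a_def)
  have step_b: "b i < b (Suc i)" if "1 \<le> i" "i < n" for i
  proof (rule ccontr)
    assume "\<not> b i < b (Suc i)"
    then have "J (Suc i) \<subseteq> J i" using J[of i] J[of "Suc i"] step_a[OF that] that by auto
    moreover have "J i \<inter> J (i + 1) \<subset> J (i + 1)"
      using chain that unfolding chain_of_intervals_def by blast
    ultimately show False by auto
  qed
  have mono_a: "1 \<le> i \<Longrightarrow> k \<le> n \<Longrightarrow> i < k \<Longrightarrow> a i < a k" for i k
  proof (induction k)
    case (Suc k)
    then show ?case using step_a[of k] by (cases "i = k") auto
  qed simp
  have mono_b: "1 \<le> i \<Longrightarrow> k \<le> n \<Longrightarrow> i < k \<Longrightarrow> b i < b k" for i k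
  proof (induction k)
    case (Suc k)
    then show ?case using step_b[of k] by (cases "i = k") auto
  qed simp
  show thesis
  proof (rule that[of a b])
    show "J i = {a i<..<b i} \<and> a i < b i \<and> 0 \<le> a i \<and> b i \<le> 1" if "i \<in> {1..n}" for i
      using J that .
    show "a 1 < a i" if "i \<in> {2..n}" for i using mono_a[of 1 i] that by simp
    show "b i < b n" if "i \<in> {1..<n}" for i using mono_b[of i n] that by simp
  qed
qed

lemma chain_like_action_if_chain_group:
  fixes G :: "('g, 'm) monoid_scheme"
  assumes "group G" and chain: "faithful_chain_action G \<phi>" and min: "minimal_action G \<phi>"
  shows "chain_like_action G \<phi>"
proof -
  have hom: "\<phi> \<in> hom G HomeoPlus" and inj: "inj_on \<phi> (carrier G)"
    using chain by (auto simp: faithful_chain_action_def)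
  interpret A: interval_action G \<phi> by (rule interval_action_if_hom[OF assms(1) hom inj])
  interpret H: interval_action HomeoPlus "\<lambda>f. f" by (rule interval_action_HomeoPlus)
  interpret A: minimal_interval_action G \<phi>
  proof
    fix x p q :: real assume x: "x \<in> {0<..<1}" and pq: "0 \<le> p" "p < q" "q \<le> 1"
    have "(p + q) / 2 \<in> unit_ivl" using pq by simp
    then have "(p + q) / 2 \<in> closure (orbit G \<phi> x)"
      using min x unfolding minimal_action_def by blast
    moreover have "(p + q) / 2 \<in> {p<..<q}" using pq by simp
    ultimately have "{p<..<q} \<inter> orbit G \<phi> x \<noteq> {}"
      by (metis IntI empty_iff open_Int_closure_eq_empty open_greaterThanLessThan)
    then show "\<exists>g\<in>carrier G. \<phi> g x \<in> {p<..<q}" by (auto simp: orbit_def)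
  qed
  obtain n f where n: "n \<ge> 2" and f: "f ` {1..n} \<subseteq> carrier HomeoPlus"
    and gen: "\<phi> ` carrier G = generate HomeoPlus (f ` {1..n})"
    and J: "chain_of_intervals n (\<lambda>i. supp (f i))"
    and left: "\<forall>i. 1 \<le> i \<and> i < n \<longrightarrow> Inf (supp (f i)) < Inf (supp (f (i + 1)))"
    and up: "\<forall>i\<in>{1..n}. \<forall>t\<in>unit_ivl. f i t \<ge> t"
    using chain unfolding faithful_chain_action_def chain_group_def by blast
  obtain a b where ab: "\<And>i. i \<in> {1..n} \<Longrightarrow>
      supp (f i) = {a i<..<b i} \<and> a i < b i \<and> 0 \<le> a i \<and> b i \<le> 1"
    and a1: "\<And>i. i \<in> {2..n} \<Longrightarrow> a 1 < a i" and bn: "\<And>i. i \<in> {1..<n} \<Longrightarrow> b i < b n"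
    using chain_of_intervals_endpoints[OF J left] by blast
  have fixed: "f i t = t" if "i \<in> {1..n}" "t \<in> {0<..<1}" "t \<le> a i \<or> b i \<le> t" for i t
  proof -
    have "t \<notin> supp (f i)" using ab[OF that(1)] that(3) by auto
    then show ?thesis using that(2) by (simp add: supp_def)
  qed
  have pushes: "t < f i t" if "i \<in> {1..n}" "t \<in> {0<..<1}" "a i < t" "t < b i" for i t
  proof -
    have "t \<in> supp (f i)" using ab that by auto
    then have "t \<in> unit_ivl" "f i t \<noteq> t" by (auto simp: supp_def)
    moreover from this have "t \<le> f i t" using up that(1) by blast
    ultimately show ?thesis by simp
  qed
  have no_fixed: "\<exists>i\<in>{1..n}. f i t \<noteq> t" if t: "t \<in> {0<..<1}" for t
  proof (rule ccontr)
    assume "\<not> ?thesis"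
    then have "\<phi> g t = t" if "g \<in> carrier G" for g
      using H.fixed_generate[OF f _ t, of "\<phi> g"] gen that by blast
    then show False using A.minimal[OF t, of 0 t] t by auto
  qed
  have n1: "1 \<in> {1..n}" "n \<in> {1..n}" using n by auto
  \<comment> \<open>Were \<open>a 1\<close> interior, it would lie left of or at the end of every
    support, hence be fixed by all generators and by the whole group, against minimality. The
    argument for \<open>b n\<close> is symmetric.\<close>
  have "a 1 = 0"
  proof (rule ccontr)
    assume "a 1 \<noteq> 0"
    then have t: "a 1 \<in> {0<..<1}" using ab[OF n1(1)] by auto
    have "f i (a 1) = a 1" if "i \<in> {1..n}" for i
      using fixed[OF that t] a1[of i] that by (cases "i = 1") auto
    then show False using no_fixed[OF t] by blast
  qed
  have "b n = 1"
  proof (rule ccontr)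
    assume "b n \<noteq> 1"
    then have t: "b n \<in> {0<..<1}" using ab[OF n1(2)] by auto
    have "f i (b n) = b n" if "i \<in> {1..n}" for i
      using fixed[OF that t] bn[of i] that by (cases "i = n") auto
    then show False using no_fixed[OF t] by blast
  qed
  have b1: "b 1 \<in> {0<..<1}" using ab[OF n1(1)] bn[of 1] \<open>b n = 1\<close> n by auto
  have an: "a n \<in> {0<..<1}" using ab[OF n1(2)] a1[of n] \<open>a 1 = 0\<close> n by auto
  have gens: "\<exists>g\<in>carrier G. \<phi> g = f i" if "i \<in> {1..n}" for i
    using gen generate.incl[of "f i" "f ` {1..n}" HomeoPlus] that by (metis imageE imageI)
  \<comment> \<open>Every generator but the first is the identity on an interval next to 0. Of two
    distinct indices at least one is not 1, so all pairs of generators have commuting germs; at the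
    other end the index \<open>n\<close> plays this part.\<close>
  have near_0: "H.commutes_near_0 (f i) (f k)" if i: "i \<in> {2..n}" and k: "k \<in> {1..n}" for i k
  proof (rule H.commutes_near_0_if_trivial)
    show "f i \<in> carrier HomeoPlus" "f k \<in> carrier HomeoPlus" using f i k by auto
    show "a i \<in> {0<..<1}" using ab[of i] a1[OF i] \<open>a 1 = 0\<close> i by auto
    show "f i t = t" if "t \<in> {0<..<1}" "t < a i" for t using fixed[of i t] that i by auto
  qed
  have near_1: "H.commutes_near_1 (f i) (f k)" if i: "i \<in> {1..<n}" and k: "k \<in> {1..n}" for i k
  proof (rule H.commutes_near_1_if_trivial)
    show "f i \<in> carrier HomeoPlus" "f k \<in> carrier HomeoPlus" using f i k by auto
    show "b i \<in> {0<..<1}" using ab[of i] bn[OF i] \<open>b n = 1\<close> i by auto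
    show "f i t = t" if "t \<in> {0<..<1}" "b i < t" for t using fixed[of i t] that i by auto
  qed
  have near_0': "H.commutes_near_0 (f i) (f k)" if "i \<in> {1..n}" "k \<in> {1..n}" for i k
  proof (cases "i = k")
    case True
    then show ?thesis unfolding H.commutes_near_0_def by (intro bexI[of _ "1/2"]) auto
  next
    case False
    then show ?thesis
      using near_0[of i k] near_0[of k i] that H.commutes_near_0_sym by (cases "i = 1") auto
  qed
  have near_1': "H.commutes_near_1 (f i) (f k)" if "i \<in> {1..n}" "k \<in> {1..n}" for i k
  proof (cases "i = k")
    case True
    then show ?thesis unfolding H.commutes_near_1_def by (intro bexI[of _ "1/2"]) auto
  next
    case False
    then show ?thesis
      using near_1[of i k] near_1[of k i] that H.commutes_near_1_sym by (cases "i = n") auto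
  qed
  show ?thesis
  proof
    obtain g where "g \<in> carrier G" "\<phi> g = f 1" using gens n1 by blast
    then show "\<exists>f\<in>carrier G. \<exists>b\<in>{0<..<1}.
      (\<forall>t\<in>{0<..<1}. t < b \<longrightarrow> t < \<phi> f t) \<and> (\<forall>t\<in>{0<..<1}. b \<le> t \<longrightarrow> \<phi> f t = t)"
      using b1 pushes[OF n1(1)] fixed[OF n1(1)] \<open>a 1 = 0\<close>
      by (intro bexI[of _ g] bexI[of _ "b 1"]) auto
    obtain g where "g \<in> carrier G" "\<phi> g = f n" using gens n1 by blast
    then show "\<exists>f\<in>carrier G. \<exists>a\<in>{0<..<1}.
      (\<forall>t\<in>{0<..<1}. a < t \<longrightarrow> t < \<phi> f t) \<and> (\<forall>t\<in>{0<..<1}. t \<le> a \<longrightarrow> \<phi> f t = t)"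
      using an pushes[OF n1(2)] fixed[OF n1(2)] \<open>b n = 1\<close>
      by (intro bexI[of _ g] bexI[of _ "a n"]) auto
  next
    fix g h assume gh: "g \<in> carrier G" "h \<in> carrier G"
    then have gen': "\<phi> g \<in> generate HomeoPlus (f ` {1..n})" "\<phi> h \<in> generate HomeoPlus (f ` {1..n})"
      using gen by blast+
    have "H.commutes_near_0 (\<phi> g) (\<phi> h)"
      using near_0' by (intro H.commutes_near_0_generate[OF f _ gen']) auto
    then show "A.commutes_near_0 g h"
      unfolding H.commutes_near_0_def A.commutes_near_0_def .
    have "H.commutes_near_1 (\<phi> g) (\<phi> h)"
      using near_1' by (intro H.commutes_near_1_generate[OF f _ gen']) auto
    then show "A.commutes_near_1 g h"
      unfolding H.commutes_near_1_def A.commutes_near_1_def .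
  qed
qed

section \<open>Extension to the closed interval\<close>

lemma extend_increasing_bij:
  fixes h :: "real \<Rightarrow> real"
  assumes bij: "bij_betw h {0<..<1} {0<..<1}" and mono: "strict_mono_on {0<..<1} h"
  defines "H \<equiv> \<lambda>x. if x \<in> {0<..<1} then h x else x"
  shows "continuous_on unit_ivl H" "bij_betw H unit_ivl unit_ivl"
proof -
  have h: "h x \<in> {0<..<1}" if "x \<in> {0<..<1}" for x using bij that by (rule bij_betw_apply)
  have less: "H x < H y" if "x < y" for x y
    using that h[of x] h[of y] strict_mono_onD[OF mono, of x y] by (auto simp: H_def)
  have inside: "H ` {0<..<1} = {0<..<1}"
    using bij_betw_imp_surj_on[OF bij] by (simp add: H_def)
  have "surj H"
    unfolding surj_def
  proof
    fix y :: real
    show "\<exists>x. y = H x"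
    proof (cases "y \<in> {0<..<1}")
      case True
      then have "y \<in> H ` {0<..<1}" using inside by simp
      then show ?thesis by blast
    next
      case False
      then show ?thesis by (auto simp: H_def)
    qed
  qed
  \<comment> \<open>Extending by the identity on the whole line makes \<open>H\<close> an increasing
    surjection of the reals, and this gives continuity without computing limits at 0 and 1.\<close>
  then have "continuous_on UNIV H"
    using less by (intro continuous_onI_mono) (auto simp: le_less)
  then show "continuous_on unit_ivl H" by (rule continuous_on_subset) simp
  have unit: "unit_ivl = insert 0 (insert 1 {0<..<1})" by auto
  have "H ` unit_ivl = unit_ivl" unfolding unit image_insert inside by (simp add: H_def)
  moreover have "inj_on H unit_ivl" using less by (intro linorder_inj_onI') (metis less_irrefl)
  ultimately show "bij_betw H unit_ivl unit_ivl" by (simp add: bij_betw_def)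
qed

text \<open>A continuous injection of an interval is monotone. The decreasing case is reduced to the
  increasing map 1 - h, and then \<open>H\<close> exchanges 0 and 1; hence the ends are controlled
  only as a set.\<close>

lemma extend_homeomorphism:
  fixes h :: "real \<Rightarrow> real"
  assumes bij: "bij_betw h {0<..<1} {0<..<1}" and cont: "continuous_on {0<..<1} h"
  obtains H K where "homeomorphism unit_ivl unit_ivl H K" "\<And>x. x \<in> {0<..<1} \<Longrightarrow> H x = h x"
    "H ` {0, 1} = {0, 1}"
proof -
  have "strict_mono_on {0<..<1} h \<or> strict_antimono_on {0<..<1} h"
    using injective_eq_monotone_map[OF is_interval_oo cont] bij_betw_imp_inj_on[OF bij] by simp
  then show thesis
  proof
    assume mono: "strict_mono_on {0<..<1} h"
    define H where "H = (\<lambda>x. if x \<in> {0<..<1} then h x else x)"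
    have H: "continuous_on unit_ivl H" "bij_betw H unit_ivl unit_ivl"
      using extend_increasing_bij[OF bij mono] by (simp_all add: H_def)
    obtain K where "homeomorphism unit_ivl unit_ivl H K"
      using homeomorphism_compact[OF compact_Icc H(1)] H(2) by (auto simp: bij_betw_def)
    then show thesis using that by (auto simp: H_def)
  next
    assume anti: "strict_antimono_on {0<..<1} h"
    define F where "F = (\<lambda>x. if x \<in> {0<..<1} then 1 - h x else x)"
    have refl: "bij_betw (\<lambda>x::real. 1 - x) {0<..<1} {0<..<1}"
      by (rule bij_betw_byWitness[where f' = "\<lambda>x. 1 - x"]) auto
    have refl': "bij_betw (\<lambda>x::real. 1 - x) unit_ivl unit_ivl"
      by (rule bij_betw_byWitness[where f' = "\<lambda>x. 1 - x"]) auto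
    have bij': "bij_betw (\<lambda>x. 1 - h x) {0<..<1} {0<..<1}"
      using bij_betw_trans[OF bij refl] by (simp add: comp_def)
    have mono: "strict_mono_on {0<..<1} (\<lambda>x. 1 - h x)"
      using anti by (auto simp: monotone_on_def)
    have F: "continuous_on unit_ivl F" "bij_betw F unit_ivl unit_ivl"
      using extend_increasing_bij[OF bij' mono] by (simp_all add: F_def)
    define H where "H = (\<lambda>x. 1 - F x)"
    have "continuous_on unit_ivl H" unfolding H_def by (intro continuous_intros F)
    moreover have "bij_betw H unit_ivl unit_ivl"
      using bij_betw_trans[OF F(2) refl'] by (simp add: H_def comp_def)
    ultimately obtain K where "homeomorphism unit_ivl unit_ivl H K"
      using homeomorphism_compact[OF compact_Icc] by (metis bij_betw_def)
    moreover have "H x = h x" if "x \<in> {0<..<1}" for x using that by (simp add: H_def F_def)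
    moreover have "H ` {0, 1} = {0, 1}" by (auto simp: H_def F_def)
    ultimately show thesis by (rule that)
  qed
qed

text \<open>A commutator that moves \<open>x\<close> in one action is a commutator for the other
  action as well, so its support there is compactly contained in the open interval.\<close>

lemma locally_moving_pair_if_chain_like:
  assumes "chain_like_action G \<alpha>" "chain_like_action G \<beta>"
  shows "locally_moving_pair G \<alpha> \<beta>"
proof -
  interpret A: chain_like_action G \<alpha> by (rule assms(1))
  interpret B: chain_like_action G \<beta> by (rule assms(2))
  show ?thesis
  proof
    fix x :: real assume "x \<in> {0<..<1}"
    then obtain a b where ab: "a \<in> carrier G" "b \<in> carrier G" "x \<in> A.moved (commutator G a b)"
      using A.commutator_moves by blast
    then show "\<exists>g\<in>carrier G. x \<in> A.moved g \<and> (\<exists>u v. 0 < u \<and> v < 1 \<and> B.moved g \<subseteq> {u..v})"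
      by (intro bexI[of _ "commutator G a b"] conjI B.commutator_compactly_moved A.commutator_closed)
  qed
qed

theorem theorem1p11:
  fixes G :: "('g, 'm) monoid_scheme"
    and \<alpha> \<beta> :: "'g \<Rightarrow> real \<Rightarrow> real"
  assumes "group G"
    and "faithful_chain_action G \<alpha>" and "minimal_action G \<alpha>"
    and "faithful_chain_action G \<beta>" and "minimal_action G \<beta>"
  shows "\<exists>h h_inv. homeomorphism unit_ivl unit_ivl h h_inv \<and>
    (\<forall>g\<in>carrier G. \<forall>x\<in>unit_ivl. \<alpha> g x = (h \<circ> \<beta> g \<circ> h_inv) x)"
proof -
  have A: "chain_like_action G \<alpha>" by (rule chain_like_action_if_chain_group[OF assms(1,2,3)])
  have B: "chain_like_action G \<beta>" by (rule chain_like_action_if_chain_group[OF assms(1,4,5)])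
  \<comment> \<open>The order \<open>\<beta>\<close>, \<open>\<alpha>\<close> makes the conjugator
    carry the points of \<open>\<beta>\<close> to those of \<open>\<alpha>\<close>, as required of
    \<open>h\<close>.\<close>
  interpret BA: bilocally_moving_pair G \<beta> \<alpha>
    by (intro bilocally_moving_pair.intro locally_moving_pair_if_chain_like A B)
  obtain h k where hk: "homeomorphism unit_ivl unit_ivl h k"
    and h: "\<And>x. x \<in> {0<..<1} \<Longrightarrow> h x = BA.AB.conjugator x" and ends: "h ` {0, 1} = {0, 1}"
    using extend_homeomorphism[OF BA.bij_betw_conjugator BA.AB.continuous_on_conjugator] by blast
  have "\<alpha> g x = h (\<beta> g (k x))" if g: "g \<in> carrier G" and x: "x \<in> unit_ivl" for g x
  proof -
    define y where "y = k x"
    have y: "y \<in> unit_ivl" "h y = x" using hk x by (auto simp: y_def homeomorphism_def)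
    have "\<alpha> g (h y) = h (\<beta> g y)"
    proof (cases "y \<in> {0<..<1}")
      case True
      then show ?thesis
        using h BA.AB.A.act_closed[OF g True] BA.AB.conjugator_act[OF g True] by simp
    next
      case False
      \<comment> \<open>Both actions fix 0 and 1, so equivariance at the ends holds whether
        \<open>h\<close> fixes or exchanges them.\<close>
      then have "y \<in> {0, 1}" using y by auto
      then have "h y \<in> {0, 1}" using ends by blast
      moreover have "\<alpha> g \<in> carrier HomeoPlus" "\<beta> g \<in> carrier HomeoPlus"
        using assms g by (auto simp: faithful_chain_action_def hom_in_carrier)
      note HomeoPlus_carrierD(3,4)[OF this(1)] HomeoPlus_carrierD(3,4)[OF this(2)]
      ultimately show ?thesis using \<open>y \<in> {0, 1}\<close> by auto
    qed
    then show ?thesis using y by (simp add: y_def)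
  qed
  then show ?thesis using hk by auto
qed

end
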